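(* Consider the $n$-player stochastic game with separately controlled chains and the quantities $J^u_\sigma$, $J^{u_i}_{\sigma,i}(y)$ described in the context. The team variance optimization problem $\min_{u\in\mathcal U^{\rm HR}}J^u_\sigma$ is equivalent to the bilevel optimization problem $$\min_{y\in\mathbb R}\ \sum_{i=1}^n\ \min_{u_i\in\mathcal U_i^{\rm HR}}J^{u_i}_{\sigma,i}(y),$$ whose inner level is decoupled into the $n$ pseudo variance optimization subproblems $\min_{u_i\in\mathcal U_i^{\rm HR}}J^{u_i}_{\sigma,i}(y)$, $i\in\mathcal I$. That is, the two problems have the same optimal value, $$\min_{u\in\mathcal U^{\rm HR}}J^u_\sigma=\min_{y\in\mathbb R}\sum_{i=1}^n\min_{u_i\in\mathcal U_i^{\rm HR}}J^{u_i}_{\sigma,i}(y),$$ and $u^*=(u_1^*,\dots,u_n^* )\in\mathcal U^{\rm HR}$ is optimal for the first problem if and only if there is $y^*\in\mathbb R$ attaining the outer minimum of the second problem such that, for each $i$, $u_i^*$ attains the inner minimum $\min_{u_i\in\mathcal U_i^{\rm HR}}J^{u_i}_{\sigma,i}(y^* )$.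
   Context: Game. There are players $\mathcal I=\{1,\dots,n\}$. Player $i$ has a finite state space $\mathcal S_i$ and a finite action space $\mathcal A_i$. Time is discrete, $t=0,1,2,\dots$; the joint state is $(s_{1,t},\dots,s_{n,t})$ and the joint action is $(a_{1,t},\dots,a_{n,t})$; the initial state is fixed. Separately controlled chains: player $i$'s state moves according to a transition probability $p_i(s_i'\mid s_i,a_i)$ depending only on its own state and action, player $i$'s reward is $r_i(s_i,a_i)\in\mathbb R$, and the joint transition probability is $\prod_{i=1}^n p_i(s_i'\mid s_i,a_i)$. Policies. Local observations: player $i$ observes only its own states, actions and rewards. Its local history at time $t$ is $h_{i,t}=(s_{i,0},a_{i,0},r_{i,0},\dots,s_{i,t-1},a_{i,t-1},r_{i,t-1},s_{i,t})$. A history-dependent randomized policy of player $i$ is a sequence $u_i=(u_{i,0},u_{i,1},\dots)$, where $u_{i,t}(\cdot\mid h_{i,t})$ is a probability distribution on $\mathcal A_i$; the players randomize independently. $\mathcal U_i^{\rm HR}$ is the set of (admissible) history-dependent randomized policies of player $i$, and $\mathcal U^{\rm HR}=\times_{i=1}^n\mathcal U_i^{\rm HR}$. Standing ergodicity assumption. For every $i$ and every stationary deterministic policy $u_i:\mathcal S_i\to\mathcal A_i$, the Markov chain on $\mathcal S_i$ with transition probabilities $p_i(s'\mid s,u_i(s))$ is ergodic (irreducible and aperiodic). $\mathcal U_i^{\rm HR}$ consists of the history-dependent randomized policies of player $i$ under which the limits as $T\to\infty$ of $\frac1T\sum_{t=0}^{T-1}r_i(s_{i,t},a_{i,t})$ and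 $\frac1T\sum_{t=0}^{T-1}r_i(s_{i,t},a_{i,t})^2$ exist almost surely. Criteria. For $u\in\mathcal U^{\rm HR}$ the team mean and team variance are $$\mu^u=\mathbb E^u\Big\{\frac1n\sum_{i=1}^n\lim_{T\to\infty}\frac1T\sum_{t=0}^{T-1}r_i(s_{i,t},a_{i,t})\Big\},\qquad J^u_\sigma=\mathbb E^u\Big\{\sum_{i=1}^n\lim_{T\to\infty}\frac1T\sum_{t=0}^{T-1}[r_i(s_{i,t},a_{i,t})-\mu^u]^2\Big\}.$$ For $y\in\mathbb R$ and $u_i\in\mathcal U_i^{\rm HR}$, the pseudo variance of player $i$ is $$J^{u_i}_{\sigma,i}(y)=\mathbb E^{u_i}\Big\{\lim_{T\to\infty}\frac1T\sum_{t=0}^{T-1}[r_i(s_{i,t},a_{i,t})-y]^2\Big\}.$$ *)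

theory Defs
  imports "HOL-Probability.Probability"
begin

text \<open>
  A trajectory is a sequence of state-action pairs. The decision rule \<open>d t \<omega> s\<close> gives the
  distribution of the action at time \<open>t\<close> when the earlier pairs are \<open>\<omega> 0, \<dots>, \<omega> (t - 1)\<close> and the
  current state is \<open>s\<close>. Carriers are sets, so that different players can have different state and
  action spaces and so that joint spaces are available as \<open>Pi\<^sub>E\<close>.
\<close>

definition step_pmf ::
  "'s \<Rightarrow> ('s \<Rightarrow> 'a \<Rightarrow> 's pmf) \<Rightarrow> (nat \<Rightarrow> (nat \<Rightarrow> 's \<times> 'a) \<Rightarrow> 's \<Rightarrow> 'a pmf)
    \<Rightarrow> nat \<Rightarrow> (nat \<Rightarrow> 's \<times> 'a) \<Rightarrow> ('s \<times> 'a) pmf" where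
  "step_pmf s0 p d t \<omega> =
    bind_pmf (if t = 0 then return_pmf s0 else p (fst (\<omega> (t - 1))) (snd (\<omega> (t - 1))))
      (\<lambda>s. map_pmf (Pair s) (d t \<omega> s))"

definition step_measure ::
  "'s set \<Rightarrow> 'a set \<Rightarrow> 's \<Rightarrow> ('s \<Rightarrow> 'a \<Rightarrow> 's pmf) \<Rightarrow> (nat \<Rightarrow> (nat \<Rightarrow> 's \<times> 'a) \<Rightarrow> 's \<Rightarrow> 'a pmf)
    \<Rightarrow> nat \<Rightarrow> (nat \<Rightarrow> 's \<times> 'a) \<Rightarrow> ('s \<times> 'a) measure" where
  "step_measure S A s0 p d t \<omega> = restrict_space (measure_pmf (step_pmf s0 p d t \<omega>)) (S \<times> A)"

text \<open>
  This is the Ionescu-Tulcea limit of the step kernels. It is meaningful only if they satisfy the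
  assumptions of that locale, which is shown below for the laws that are used.
\<close>

definition trajectory_law ::
  "'s set \<Rightarrow> 'a set \<Rightarrow> 's \<Rightarrow> ('s \<Rightarrow> 'a \<Rightarrow> 's pmf) \<Rightarrow> (nat \<Rightarrow> (nat \<Rightarrow> 's \<times> 'a) \<Rightarrow> 's \<Rightarrow> 'a pmf)
    \<Rightarrow> (nat \<Rightarrow> 's \<times> 'a) measure" where
  "trajectory_law S A s0 p d =
    projective_family.lim UNIV
      (Ionescu_Tulcea.CI (step_measure S A s0 p d) (\<lambda>_. count_space (S \<times> A)))
      (\<lambda>_. count_space (S \<times> A))"

lemma set_step_pmf:
  assumes "s0 \<in> S"
    and "\<And>s a. s \<in> S \<Longrightarrow> a \<in> A \<Longrightarrow> set_pmf (p s a) \<subseteq> S"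
    and "\<And>t \<omega> s. \<forall>k<t. \<omega> k \<in> S \<times> A \<Longrightarrow> s \<in> S \<Longrightarrow> set_pmf (d t \<omega> s) \<subseteq> A"
    and "\<forall>k<t. \<omega> k \<in> S \<times> A"
  shows "set_pmf (step_pmf s0 p d t \<omega>) \<subseteq> S \<times> A"
proof (cases "t = 0")
  case True
  then show ?thesis
    using assms(1) assms(3)[of t \<omega> s0] assms(4) by (auto simp: step_pmf_def)
next
  case False
  then have "\<omega> (t - 1) \<in> S \<times> A"
    using assms(4) by simp
  then have "set_pmf (p (fst (\<omega> (t - 1))) (snd (\<omega> (t - 1)))) \<subseteq> S"
    by (intro assms(2)) (simp_all add: mem_Times_iff)
  moreover have "set_pmf (d t \<omega> s) \<subseteq> A" if "s \<in> S" for s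
    using assms(3,4) that by blast
  ultimately show ?thesis
    unfolding step_pmf_def using False by (simp add: subset_iff) blast
qed

lemma Ionescu_Tulcea_step_measure:
  assumes "finite S" "finite A" "s0 \<in> S"
    and "\<And>s a. s \<in> S \<Longrightarrow> a \<in> A \<Longrightarrow> set_pmf (p s a) \<subseteq> S"
    and "\<And>t \<omega> s. \<forall>k<t. \<omega> k \<in> S \<times> A \<Longrightarrow> s \<in> S \<Longrightarrow> set_pmf (d t \<omega> s) \<subseteq> A"
  shows "Ionescu_Tulcea (step_measure S A s0 p d) (\<lambda>_. count_space (S \<times> A))"
proof -
  have PiM: "PiM {0..<t} (\<lambda>_. count_space (S \<times> A)) = count_space (PiE {0..<t} (\<lambda>_. S \<times> A))"
    for t :: nat
    using assms(1,2) by (intro count_space_PiM_finite) (auto intro: countable_finite)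
  have prob: "prob_space (step_measure S A s0 p d t \<omega>)"
    if "\<omega> \<in> PiE {0..<t} (\<lambda>_. S \<times> A)" for t \<omega>
  proof -
    have "set_pmf (step_pmf s0 p d t \<omega>) \<subseteq> S \<times> A"
      using that by (intro set_step_pmf assms) (simp_all add: PiE_iff)
    then have "measure_pmf.prob (step_pmf s0 p d t \<omega>) (S \<times> A) = 1"
      by (auto simp: measure_pmf.prob_eq_1 AE_measure_pmf_iff)
    then show ?thesis
      unfolding step_measure_def
      by (intro prob_spaceI) (simp add: emeasure_restrict_space measure_pmf.emeasure_eq_measure)
  qed
  have sets: "sets (step_measure S A s0 p d t \<omega>) = sets (count_space (S \<times> A))" for t \<omega>
    by (auto simp: step_measure_def sets_restrict_space)
  show ?thesis
  proof (rule Ionescu_Tulcea.intro)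
    fix t :: nat
    show "step_measure S A s0 p d t \<in> measurable (PiM {0..<t} (\<lambda>_. count_space (S \<times> A)))
      (subprob_algebra (count_space (S \<times> A)))"
      unfolding PiM using prob sets
      by (auto simp: space_subprob_algebra intro!: prob_space_imp_subprob_space)
  next
    fix t :: nat and \<omega> assume "\<omega> \<in> space (PiM {0..<t} (\<lambda>_. count_space (S \<times> A)))"
    then show "prob_space (step_measure S A s0 p d t \<omega>)"
      by (intro prob) (simp add: space_PiM)
  qed
qed

primrec nstep :: "('s \<Rightarrow> 's pmf) \<Rightarrow> nat \<Rightarrow> 's \<Rightarrow> 's pmf" where
  "nstep K 0 s = return_pmf s"
| "nstep K (Suc k) s = bind_pmf (nstep K k s) K"

definition irreducible_chain :: "'s set \<Rightarrow> ('s \<Rightarrow> 's pmf) \<Rightarrow> bool" where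
  "irreducible_chain S K \<longleftrightarrow> (\<forall>s\<in>S. \<forall>s'\<in>S. \<exists>k. pmf (nstep K k s) s' > 0)"

definition aperiodic_chain :: "'s set \<Rightarrow> ('s \<Rightarrow> 's pmf) \<Rightarrow> bool" where
  "aperiodic_chain S K \<longleftrightarrow> (\<forall>s\<in>S. Gcd {k. k > 0 \<and> pmf (nstep K k s) s > 0} = 1)"

definition ergodic_chain :: "'s set \<Rightarrow> ('s \<Rightarrow> 's pmf) \<Rightarrow> bool" where
  "ergodic_chain S K \<longleftrightarrow> irreducible_chain S K \<and> aperiodic_chain S K"

record ('s, 'a) game =
  nplayers :: nat
  states :: "nat \<Rightarrow> 's set"
  actions :: "nat \<Rightarrow> 'a set"
  init :: "nat \<Rightarrow> 's"
  trans :: "nat \<Rightarrow> 's \<Rightarrow> 'a \<Rightarrow> 's pmf"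
  reward :: "nat \<Rightarrow> 's \<Rightarrow> 'a \<Rightarrow> real"

definition players :: "('s, 'a) game \<Rightarrow> nat set" where
  "players G = {1..nplayers G}"

definition valid_game :: "('s, 'a) game \<Rightarrow> bool" where
  "valid_game G \<longleftrightarrow> nplayers G \<ge> 1 \<and>
    (\<forall>i\<in>players G.
      finite (states G i) \<and> finite (actions G i) \<and> actions G i \<noteq> {} \<and>
      init G i \<in> states G i \<and>
      (\<forall>s\<in>states G i. \<forall>a\<in>actions G i. set_pmf (trans G i s a) \<subseteq> states G i))"

definition ergodic_game :: "('s, 'a) game \<Rightarrow> bool" where
  "ergodic_game G \<longleftrightarrow>
    (\<forall>i\<in>players G. \<forall>f \<in> states G i \<rightarrow> actions G i.
      ergodic_chain (states G i) (\<lambda>s. trans G i s (f s)))"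

type_synonym ('s, 'a) history = "('s \<times> 'a \<times> real) list \<times> 's"
type_synonym ('s, 'a) policy = "nat \<Rightarrow> ('s, 'a) history \<Rightarrow> 'a pmf"

definition histories :: "('s, 'a) game \<Rightarrow> nat \<Rightarrow> nat \<Rightarrow> ('s, 'a) history set" where
  "histories G i t = {(xs, s). length xs = t \<and> s \<in> states G i \<and>
    (\<forall>(s', a, x)\<in>set xs. s' \<in> states G i \<and> a \<in> actions G i \<and> x = reward G i s' a)}"

definition history_of ::
  "('s, 'a) game \<Rightarrow> nat \<Rightarrow> nat \<Rightarrow> (nat \<Rightarrow> 's \<times> 'a) \<Rightarrow> 's \<Rightarrow> ('s, 'a) history" where
  "history_of G i t \<tau> s =
    (map (\<lambda>k. (fst (\<tau> k), snd (\<tau> k), reward G i (fst (\<tau> k)) (snd (\<tau> k)))) [0..<t], s)"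

definition randomized_policies :: "('s, 'a) game \<Rightarrow> nat \<Rightarrow> ('s, 'a) policy set" where
  "randomized_policies G i = {u. \<forall>t. \<forall>h\<in>histories G i t. set_pmf (u t h) \<subseteq> actions G i}"

definition player_law ::
  "('s, 'a) game \<Rightarrow> nat \<Rightarrow> ('s, 'a) policy \<Rightarrow> (nat \<Rightarrow> 's \<times> 'a) measure" where
  "player_law G i u =
    trajectory_law (states G i) (actions G i) (init G i) (trans G i)
      (\<lambda>t \<tau> s. u t (history_of G i t \<tau> s))"

definition rewards :: "('s, 'a) game \<Rightarrow> nat \<Rightarrow> (nat \<Rightarrow> 's \<times> 'a) \<Rightarrow> nat \<Rightarrow> real" where
  "rewards G i \<tau> t = reward G i (fst (\<tau> t)) (snd (\<tau> t))"

definition averages :: "(nat \<Rightarrow> real) \<Rightarrow> nat \<Rightarrow> real" where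
  "averages x T = (1 / real T) * (\<Sum>t<T. x t)"

definition admissible_policies :: "('s, 'a) game \<Rightarrow> nat \<Rightarrow> ('s, 'a) policy set" where
  "admissible_policies G i = {u \<in> randomized_policies G i.
    (AE \<tau> in player_law G i u. convergent (averages (rewards G i \<tau>))) \<and>
    (AE \<tau> in player_law G i u. convergent (averages (\<lambda>t. (rewards G i \<tau> t)\<^sup>2)))}"

definition joint_policies :: "('s, 'a) game \<Rightarrow> (nat \<Rightarrow> ('s, 'a) policy) set" where
  "joint_policies G = (\<Pi>\<^sub>E i\<in>players G. admissible_policies G i)"

text \<open>
  Joint states and joint actions are extensional functions of the player, which is why the
  product distributions take the value \<open>undefined\<close> outside the set of players.
\<close>

definition component :: "nat \<Rightarrow> (nat \<Rightarrow> (nat \<Rightarrow> 's) \<times> (nat \<Rightarrow> 'a)) \<Rightarrow> nat \<Rightarrow> 's \<times> 'a" where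
  "component i \<omega> = (\<lambda>t. (fst (\<omega> t) i, snd (\<omega> t) i))"

definition joint_trans ::
  "('s, 'a) game \<Rightarrow> (nat \<Rightarrow> 's) \<Rightarrow> (nat \<Rightarrow> 'a) \<Rightarrow> (nat \<Rightarrow> 's) pmf" where
  "joint_trans G s a = Pi_pmf (players G) undefined (\<lambda>i. trans G i (s i) (a i))"

definition joint_decision ::
  "('s, 'a) game \<Rightarrow> (nat \<Rightarrow> ('s, 'a) policy)
    \<Rightarrow> nat \<Rightarrow> (nat \<Rightarrow> (nat \<Rightarrow> 's) \<times> (nat \<Rightarrow> 'a)) \<Rightarrow> (nat \<Rightarrow> 's) \<Rightarrow> (nat \<Rightarrow> 'a) pmf" where
  "joint_decision G u t \<omega> s =
    Pi_pmf (players G) undefined (\<lambda>i. u i t (history_of G i t (component i \<omega>) (s i)))"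

definition joint_law ::
  "('s, 'a) game \<Rightarrow> (nat \<Rightarrow> ('s, 'a) policy) \<Rightarrow> (nat \<Rightarrow> (nat \<Rightarrow> 's) \<times> (nat \<Rightarrow> 'a)) measure" where
  "joint_law G u =
    trajectory_law (\<Pi>\<^sub>E i\<in>players G. states G i) (\<Pi>\<^sub>E i\<in>players G. actions G i)
      (restrict (init G) (players G)) (joint_trans G) (joint_decision G u)"

lemma history_of_mem:
  assumes "\<forall>k<t. \<tau> k \<in> states G i \<times> actions G i" "s \<in> states G i"
  shows "history_of G i t \<tau> s \<in> histories G i t"
  using assms by (auto simp: history_of_def histories_def mem_Times_iff)

lemma Ionescu_Tulcea_player:
  assumes "valid_game G" "i \<in> players G" "u \<in> randomized_policies G i"
  shows "Ionescu_Tulcea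
    (step_measure (states G i) (actions G i) (init G i) (trans G i)
      (\<lambda>t \<tau> s. u t (history_of G i t \<tau> s)))
    (\<lambda>_. count_space (states G i \<times> actions G i))"
proof (rule Ionescu_Tulcea_step_measure)
  show "set_pmf (u t (history_of G i t \<tau> s)) \<subseteq> actions G i"
    if "\<forall>k<t. \<tau> k \<in> states G i \<times> actions G i" "s \<in> states G i" for t \<tau> s
    using assms(3) history_of_mem[OF that] unfolding randomized_policies_def by blast
qed (use assms in \<open>auto simp: valid_game_def\<close>)

lemma Ionescu_Tulcea_joint:
  assumes "valid_game G" "\<And>i. i \<in> players G \<Longrightarrow> u i \<in> randomized_policies G i"
  defines "S \<equiv> \<Pi>\<^sub>E i\<in>players G. states G i" and "A \<equiv> \<Pi>\<^sub>E i\<in>players G. actions G i"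
  shows "Ionescu_Tulcea
    (step_measure S A (restrict (init G) (players G)) (joint_trans G) (joint_decision G u))
    (\<lambda>_. count_space (S \<times> A))"
proof (rule Ionescu_Tulcea_step_measure)
  have fin: "finite (players G)"
    by (simp add: players_def)
  show "finite S" "finite A"
    using assms(1) fin unfolding S_def A_def valid_game_def by (auto intro!: finite_PiE)
  show "restrict (init G) (players G) \<in> S"
    using assms(1) unfolding S_def valid_game_def by auto
  show "set_pmf (joint_trans G s a) \<subseteq> S" if "s \<in> S" "a \<in> A" for s a
  proof -
    have "set_pmf (trans G i (s i) (a i)) \<subseteq> states G i" if "i \<in> players G" for i
      using assms(1) \<open>s \<in> S\<close> \<open>a \<in> A\<close> that unfolding S_def A_def valid_game_def by blast
    then show ?thesis
      using fin unfolding joint_trans_def S_def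
      by (auto simp: set_Pi_pmf PiE_dflt_def PiE_iff extensional_def)
  qed
  show "set_pmf (joint_decision G u t \<omega> s) \<subseteq> A" if "\<forall>k<t. \<omega> k \<in> S \<times> A" "s \<in> S" for t \<omega> s
  proof -
    have "set_pmf (u i t (history_of G i t (component i \<omega>) (s i))) \<subseteq> actions G i"
      if i: "i \<in> players G" for i
    proof -
      have "component i \<omega> k \<in> states G i \<times> actions G i" if "k < t" for k
      proof -
        have "fst (\<omega> k) \<in> S" "snd (\<omega> k) \<in> A"
          using \<open>\<forall>k<t. \<omega> k \<in> S \<times> A\<close> that by (auto simp: mem_Times_iff)
        then show ?thesis
          using i unfolding S_def A_def component_def by auto
      qed
      moreover have "s i \<in> states G i"
        using \<open>s \<in> S\<close> i unfolding S_def by auto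
      ultimately have "history_of G i t (component i \<omega>) (s i) \<in> histories G i t"
        by (intro history_of_mem) auto
      then show ?thesis
        using assms(2)[OF i] unfolding randomized_policies_def by blast
    qed
    then show ?thesis
      using fin unfolding joint_decision_def A_def
      by (auto simp: set_Pi_pmf PiE_dflt_def PiE_iff extensional_def)
  qed
qed

definition team_mean :: "('s, 'a) game \<Rightarrow> (nat \<Rightarrow> ('s, 'a) policy) \<Rightarrow> real" where
  "team_mean G u =
    (\<integral>\<omega>. (1 / real (nplayers G)) *
      (\<Sum>i\<in>players G. lim (averages (rewards G i (component i \<omega>)))) \<partial>joint_law G u)"

definition team_variance :: "('s, 'a) game \<Rightarrow> (nat \<Rightarrow> ('s, 'a) policy) \<Rightarrow> real" where
  "team_variance G u =
    (\<integral>\<omega>. (\<Sum>i\<in>players G.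
      lim (averages (\<lambda>t. (rewards G i (component i \<omega>) t - team_mean G u)\<^sup>2))) \<partial>joint_law G u)"

definition pseudo_variance :: "('s, 'a) game \<Rightarrow> nat \<Rightarrow> real \<Rightarrow> ('s, 'a) policy \<Rightarrow> real" where
  "pseudo_variance G i y u =
    (\<integral>\<tau>. lim (averages (\<lambda>t. (rewards G i \<tau> t - y)\<^sup>2)) \<partial>player_law G i u)"

definition bilevel_objective :: "('s, 'a) game \<Rightarrow> real \<Rightarrow> real" where
  "bilevel_objective G y =
    (\<Sum>i\<in>players G. INF u\<in>admissible_policies G i. pseudo_variance G i y u)"

end

theory Submission
  imports Defs
begin

text \<open>
  Two facts carry the proof. The first is the identity
  \<open>\<Sum>i. J\<^sub>i(y, u\<^sub>i) = J(u) + n * (y - \<mu>\<^sup>u)\<^sup>2\<close> (lemma \<open>sum_pseudo_variance\<close>), where \<open>J\<^sub>i\<close> is the pseudo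
  variance of player \<open>i\<close>, \<open>J\<close> the team variance and \<open>n\<close> the number of players: for fixed policies
  the best centre is the team mean, and there the sum of the pseudo variances is the team variance.
  Minimising over \<open>u\<close> and \<open>y\<close> in either order thus gives the same value, provided that the minima are
  attained. The second fact is that, for every \<open>y\<close>, the pseudo variance of a player is minimised over
  all admissible policies by one of the finitely many stationary deterministic policies (lemma
  \<open>stationary_optimal\<close>). Because that finite set serves all \<open>y\<close> at once, the team problem has a
  stationary deterministic solution \<open>w\<close>, the outer minimum is attained at the mean of \<open>w\<close>, and
  comparing an arbitrary profile with \<open>w\<close> gives the characterisation of the optimal profiles.

  The identity needs the marginals of the joint law: because the players move and randomise
  independently, the trajectory of player \<open>i\<close> under the joint law has the law of the process that
  player \<open>i\<close> controls alone (lemma \<open>distr_component\<close>). A law on trajectories is determined by the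
  probabilities of its finite prefixes, so this is checked one step at a time.

  Optimality of stationary policies is average cost dynamic programming with the running cost
  \<open>(r\<^sub>i - y)\<^sup>2\<close>. Irreducibility makes the Poisson equation of every stationary policy solvable, and
  changing the action of a policy of minimal gain in a single state shows that its gain \<open>g\<close> and
  bias \<open>h\<close> satisfy \<open>g + h(s) \<le> c(s, a) + \<Sum>s'. p(s' | s, a) h(s')\<close> (lemma \<open>optimality_inequality\<close>).
  Telescoping this inequality bounds the long-run expected cost of any policy below by \<open>g\<close> (lemma
  \<open>gain_lower_bound\<close>). Conversely the cost averages along a stationary policy converge almost surely
  to its gain: by the Poisson equation they differ from it by a vanishing boundary term and an
  average of bounded martingale differences, whose fourth moments are small enough to be summed
  (lemma \<open>martingale_strong_law\<close>). The same law of large numbers shows that stationary policies are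
  admissible.
\<close>

section \<open>Laws of controlled processes with finite spaces\<close>

text \<open>
  A function of a trajectory that looks only at times before \<open>n\<close>. On finite spaces this replaces
  measurability with respect to the \<open>n\<close>-th element of the natural filtration, and it makes sense for
  arbitrary trajectories and values.
\<close>

definition determined_by :: "nat \<Rightarrow> ((nat \<Rightarrow> 'z) \<Rightarrow> 'b) \<Rightarrow> bool" where
  "determined_by n F \<longleftrightarrow> (\<forall>\<omega> \<omega>'. (\<forall>k<n. \<omega> k = \<omega>' k) \<longrightarrow> F \<omega> = F \<omega>')"

lemma determined_byD: "determined_by n F \<Longrightarrow> (\<And>k. k < n \<Longrightarrow> \<omega> k = \<omega>' k) \<Longrightarrow> F \<omega> = F \<omega>'"
  by (auto simp: determined_by_def)

lemma determined_byI:
  "(\<And>\<omega> \<omega>'. (\<And>k. k < n \<Longrightarrow> \<omega> k = \<omega>' k) \<Longrightarrow> F \<omega> = F \<omega>') \<Longrightarrow> determined_by n F"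
  unfolding determined_by_def by blast

text \<open>
  Decision rules must be determined by the past. The Ionescu-Tulcea kernels see the past only as a
  function that is \<open>undefined\<close> from time \<open>t\<close> on, so without this requirement a decision rule could
  act differently on a trajectory and on its truncation.
\<close>

locale controlled_process =
  fixes S :: "'s set" and A :: "'a set" and s0 :: 's and p :: "'s \<Rightarrow> 'a \<Rightarrow> 's pmf"
    and d :: "nat \<Rightarrow> (nat \<Rightarrow> 's \<times> 'a) \<Rightarrow> 's \<Rightarrow> 'a pmf"
  assumes finite_S: "finite S" and finite_A: "finite A" and init: "s0 \<in> S"
    and trans_closed: "\<And>s a. s \<in> S \<Longrightarrow> a \<in> A \<Longrightarrow> set_pmf (p s a) \<subseteq> S"
    and decision_closed:
      "\<And>t \<omega> s. \<forall>k<t. \<omega> k \<in> S \<times> A \<Longrightarrow> s \<in> S \<Longrightarrow> set_pmf (d t \<omega> s) \<subseteq> A"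
    and decision_adapted: "\<And>t s. determined_by t (\<lambda>\<omega>. d t \<omega> s)"
begin

abbreviation step :: "nat \<Rightarrow> (nat \<Rightarrow> 's \<times> 'a) \<Rightarrow> ('s \<times> 'a) pmf" where
  "step \<equiv> step_pmf s0 p d"

abbreviation law :: "(nat \<Rightarrow> 's \<times> 'a) measure" where
  "law \<equiv> trajectory_law S A s0 p d"

sublocale IT: Ionescu_Tulcea "step_measure S A s0 p d" "\<lambda>_. count_space (S \<times> A)"
  by (rule Ionescu_Tulcea_step_measure)
    (use finite_S finite_A init trans_closed decision_closed in auto)

lemma law_eq: "law = IT.PF.lim"
  by (simp add: trajectory_law_def)

lemma finite_E: "finite (S \<times> A)"
  using finite_S finite_A by simp

lemma space_law: "space law = (UNIV \<rightarrow>\<^sub>E S \<times> A)"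
  unfolding law_eq by (simp add: space_PiM)

lemma sets_law [measurable_cong]: "sets law = sets (PiM UNIV (\<lambda>_. count_space (S \<times> A)))"
  unfolding law_eq by simp

lemma in_space_law: "\<omega> \<in> space law \<Longrightarrow> \<omega> k \<in> S \<times> A"
  unfolding space_law by (rule PiE_mem) auto

lemma PiM_prefix:
  "PiM {0..<n} (\<lambda>_. count_space (S \<times> A)) = count_space (PiE {0..<n} (\<lambda>_. S \<times> A))" for n :: nat
  using finite_E by (intro count_space_PiM_finite) (auto intro: countable_finite)

lemma set_step: "\<forall>k<t. \<omega> k \<in> S \<times> A \<Longrightarrow> set_pmf (step t \<omega>) \<subseteq> S \<times> A"
  by (rule set_step_pmf) (use init trans_closed decision_closed in auto)

lemma step_adapted: "determined_by t (step t)"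
proof (rule determined_byI)
  fix \<omega> \<omega>' :: "nat \<Rightarrow> 's \<times> 'a" assume eq: "\<And>k. k < t \<Longrightarrow> \<omega> k = \<omega>' k"
  have "d t \<omega> = d t \<omega>'"
    using determined_byD[OF decision_adapted eq] by auto
  moreover have "t \<noteq> 0 \<Longrightarrow> \<omega> (t - 1) = \<omega>' (t - 1)"
    using eq by simp
  ultimately show "step t \<omega> = step t \<omega>'"
    by (auto simp: step_pmf_def)
qed

definition weight :: "nat \<Rightarrow> (nat \<Rightarrow> 's \<times> 'a) \<Rightarrow> real" where
  "weight n x = (\<Prod>k<n. pmf (step k x) (x k))"

lemma weight_adapted: "determined_by n (weight n)"
proof (rule determined_byI)
  fix x y :: "nat \<Rightarrow> 's \<times> 'a" assume eq: "\<And>k. k < n \<Longrightarrow> x k = y k"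
  have "step k x = step k y" if "k < n" for k
    by (rule determined_byD[OF step_adapted]) (use eq that in auto)
  then show "weight n x = weight n y"
    unfolding weight_def by (intro prod.cong) (auto simp: eq)
qed

text \<open>
  The \<open>n\<close>-step composition of the kernels lives on a finite set of prefixes, and its point masses
  satisfy the recursion of \<open>weight\<close>: a prefix of length \<open>n + 1\<close> is reached only from its
  restriction to the first \<open>n\<close> times.
\<close>

lemma emeasure_prefix_kernel:
  assumes "\<And>k. k < n \<Longrightarrow> x k \<in> S \<times> A"
  shows "emeasure (IT.C 0 n (\<lambda>_. undefined)) {restrict x {0..<n}} = ennreal (weight n x)"
  using assms
proof (induction n)
  case 0
  then show ?case by (simp add: weight_def PiM_empty)
next
  case (Suc n)
  let ?M = "\<lambda>_::nat. count_space (S \<times> A)"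
  let ?u = "\<lambda>_::nat. undefined :: 's \<times> 'a"
  let ?x = "restrict x {0..<n}" and ?x' = "restrict x {0..<Suc n}"
  have u: "?u \<in> space (PiM {0..<0} ?M)" by simp
  have x_in: "?x \<in> PiE {0..<n} (\<lambda>_. S \<times> A)" and x'_in: "?x' \<in> PiE {0..<Suc n} (\<lambda>_. S \<times> A)"
    using Suc.prems by auto
  have xn: "x n \<in> S \<times> A" using Suc.prems by simp
  have step_x: "step n ?x = step n x"
    by (rule determined_byD[OF step_adapted]) simp
  have eP: "emeasure (IT.eP n \<omega>) {?x'} = ennreal (pmf (step n x) (x n)) * indicator {?x} \<omega>"
    if \<omega>: "\<omega> \<in> PiE {0..<n} (\<lambda>_. S \<times> A)" for \<omega>
  proof -
    have eq: "fun_upd \<omega> n -` {?x'} \<inter> S \<times> A = (if \<omega> = ?x then {x n} else {})"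
    proof -
      have "(fun_upd \<omega> n z = ?x') = (\<omega> = ?x \<and> z = x n)" for z
      proof
        assume h: "fun_upd \<omega> n z = ?x'"
        have "z = x n" using fun_cong[OF h, of n] by simp
        moreover have "\<omega> k = ?x k" for k
        proof (cases "k < n")
          case True
          then show ?thesis using fun_cong[OF h, of k] by simp
        next
          case False
          then show ?thesis using \<omega> by (auto simp: PiE_def extensional_def)
        qed
        ultimately show "\<omega> = ?x \<and> z = x n" by auto
      next
        assume "\<omega> = ?x \<and> z = x n"
        then show "fun_upd \<omega> n z = ?x'" by (auto simp: fun_eq_iff)
      qed
      then show ?thesis using xn by auto
    qed
    have "emeasure (IT.eP n \<omega>) {?x'} =
        emeasure (step_measure S A s0 p d n \<omega>) (fun_upd \<omega> n -` {?x'} \<inter> S \<times> A)"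
      using \<omega> x'_in by (subst IT.emeasure_eP) (auto simp: space_PiM PiM_prefix)
    also have "\<dots> = ennreal (pmf (step n x) (x n)) * indicator {?x} \<omega>"
      using xn step_x unfolding eq step_measure_def
      by (auto simp: emeasure_restrict_space emeasure_pmf_single)
    finally show ?thesis .
  qed
  have sp: "space (IT.C 0 n ?u) = PiE {0..<n} (\<lambda>_. S \<times> A)"
    using IT.space_C[OF u, of n] by (simp add: space_PiM)
  have st: "sets (IT.C 0 n ?u) = sets (count_space (PiE {0..<n} (\<lambda>_. S \<times> A)))"
    using IT.sets_C[OF u, of n] by (simp add: PiM_prefix)
  have "emeasure (IT.C 0 (Suc n) ?u) {?x'} = (\<integral>\<^sup>+\<omega>. emeasure (IT.eP n \<omega>) {?x'} \<partial>IT.C 0 n ?u)"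
  proof -
    have "IT.eP n \<in> measurable (IT.C 0 n ?u) (subprob_algebra (PiM {0..<Suc n} ?M))"
      using IT.measurable_eP[of n] by (simp add: measurable_cong_sets[OF IT.sets_C[OF u, of n] refl])
    moreover have "{?x'} \<in> sets (PiM {0..<Suc n} ?M)"
      using x'_in by (simp add: PiM_prefix)
    moreover have "space (IT.C 0 n ?u) \<noteq> {}" using x_in unfolding sp by blast
    ultimately show ?thesis by (simp add: emeasure_bind)
  qed
  also have "\<dots> = (\<integral>\<^sup>+\<omega>. ennreal (pmf (step n x) (x n)) * indicator {?x} \<omega> \<partial>IT.C 0 n ?u)"
    by (intro nn_integral_cong) (simp add: sp eP)
  also have "\<dots> = ennreal (pmf (step n x) (x n)) * emeasure (IT.C 0 n ?u) {?x}"
    using x_in by (intro nn_integral_cmult_indicator) (simp add: st)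
  also have "\<dots> = ennreal (weight (Suc n) x)"
  proof -
    have "emeasure (IT.C 0 n ?u) {?x} = ennreal (weight n x)"
      by (rule Suc.IH) (use Suc.prems in simp)
    then show ?thesis
      unfolding weight_def by (simp only: ennreal_mult[symmetric] prod_nonneg pmf_nonneg) (simp add: mult.commute)
  qed
  finally show ?case .
qed

lemma emb_prefix:
  assumes "\<And>k. k < n \<Longrightarrow> x k \<in> S \<times> A"
  shows "IT.PF.emb UNIV {0..<n} {restrict x {0..<n}} = {\<omega> \<in> space law. \<forall>k<n. \<omega> k = x k}"
proof -
  have "(restrict \<omega> {0..<n} = restrict x {0..<n}) = (\<forall>k<n. \<omega> k = x k)" for \<omega>
    by (auto simp: fun_eq_iff restrict_def)
  then show ?thesis
    by (auto simp: prod_emb_def space_law)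
qed

lemma emeasure_prefix:
  assumes "\<And>k. k < n \<Longrightarrow> x k \<in> S \<times> A"
  shows "emeasure law {\<omega> \<in> space law. \<forall>k<n. \<omega> k = x k} = ennreal (weight n x)"
proof -
  have x_in: "restrict x {0..<n} \<in> PiE {0..<n} (\<lambda>_. S \<times> A)"
    using assms by auto
  have "emeasure law {\<omega> \<in> space law. \<forall>k<n. \<omega> k = x k} = emeasure (IT.CI {0..<n}) {restrict x {0..<n}}"
  proof (subst emb_prefix[of n x, symmetric])
    show "emeasure law (IT.PF.emb UNIV {0..<n} {restrict x {0..<n}}) = emeasure (IT.CI {0..<n}) {restrict x {0..<n}}"
      unfolding law_eq by (rule IT.lim) (use x_in in \<open>simp_all add: PiM_prefix\<close>)
  qed (use assms in simp)
  also have "\<dots> = emeasure (IT.C 0 n (\<lambda>_. undefined)) {restrict x {0..<n}}"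
    using x_in by (subst IT.emeasure_CI[of _ n]) (auto simp: PiM_prefix prod_emb_id)
  finally show ?thesis
    using emeasure_prefix_kernel[OF assms] by simp
qed

lemma prob_space_law: "prob_space law"
  using emeasure_prefix[of 0 "\<lambda>_. undefined"] by (intro prob_spaceI) (simp add: weight_def)

lemma prefix_set_measurable [measurable]: "{\<omega> \<in> space law. \<forall>k<n. \<omega> k = x k} \<in> sets law"
proof -
  have "{\<omega> \<in> space law. \<omega> k = x k} \<in> sets law" for k
  proof -
    have "(\<lambda>\<omega>. \<omega> k) \<in> measurable law (count_space (S \<times> A))"
      by measurable
    then have "(\<lambda>\<omega>. \<omega> k) -` ({x k} \<inter> (S \<times> A)) \<inter> space law \<in> sets law"
      by (rule measurable_sets) simp
    moreover have "(\<lambda>\<omega>. \<omega> k) -` ({x k} \<inter> (S \<times> A)) \<inter> space law = {\<omega> \<in> space law. \<omega> k = x k}"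
      using in_space_law by auto
    ultimately show ?thesis by simp
  qed
  then have "{\<omega> \<in> space law. \<forall>k\<in>{..<n}. \<omega> k = x k} \<in> sets law"
    by (intro sets.sets_Collect_finite_All) auto
  then show ?thesis by (simp add: Ball_def)
qed

lemma finite_prefixes: "finite (PiE {..<n} (\<lambda>_. S \<times> A))" for n :: nat
  using finite_E by (intro finite_PiE) auto

text \<open>
  There are finitely many prefixes of length \<open>n\<close>, so a function determined by them is a simple
  function. Measurability, integrability and the formula for the expectation all follow from this
  expansion.
\<close>

lemma determined_by_expand:
  fixes F :: "(nat \<Rightarrow> 's \<times> 'a) \<Rightarrow> real"
  assumes "determined_by n F" "\<omega> \<in> space law"
  shows "F \<omega> = (\<Sum>x\<in>PiE {..<n} (\<lambda>_. S \<times> A).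
    F x * indicator {\<omega> \<in> space law. \<forall>k<n. \<omega> k = x k} \<omega>)"
proof -
  have mem: "restrict \<omega> {..<n} \<in> PiE {..<n} (\<lambda>_. S \<times> A)"
    using in_space_law[OF assms(2)] by auto
  have "(\<Sum>x\<in>PiE {..<n} (\<lambda>_. S \<times> A). F x * indicator {\<omega> \<in> space law. \<forall>k<n. \<omega> k = x k} \<omega>)
    = (\<Sum>x\<in>PiE {..<n} (\<lambda>_. S \<times> A). if x = restrict \<omega> {..<n} then F x else 0)"
  proof (intro sum.cong refl)
    fix x assume x: "x \<in> PiE {..<n} (\<lambda>_. S \<times> A)"
    have "(\<forall>k<n. \<omega> k = x k) \<longleftrightarrow> x = restrict \<omega> {..<n}"
      using x by (auto simp: fun_eq_iff PiE_def extensional_def)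
    then show "F x * indicator {\<omega> \<in> space law. \<forall>k<n. \<omega> k = x k} \<omega> =
        (if x = restrict \<omega> {..<n} then F x else 0)"
      using assms(2) by (auto simp: indicator_def)
  qed
  also have "\<dots> = F (restrict \<omega> {..<n})"
    using mem finite_prefixes by simp
  also have "\<dots> = F \<omega>"
    by (rule determined_byD[OF assms(1)]) simp
  finally show ?thesis by simp
qed

lemma determined_by_measurable:
  fixes F :: "(nat \<Rightarrow> 's \<times> 'a) \<Rightarrow> real"
  assumes "determined_by n F"
  shows "F \<in> borel_measurable law"
proof -
  have "(\<lambda>\<omega>. \<Sum>x\<in>PiE {..<n} (\<lambda>_. S \<times> A). F x * indicator {\<omega> \<in> space law. \<forall>k<n. \<omega> k = x k} \<omega>)
    \<in> borel_measurable law"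
    by measurable
  then show ?thesis
    using determined_by_expand[OF assms] by (subst measurable_cong) auto
qed

lemma determined_by_integrable:
  fixes F :: "(nat \<Rightarrow> 's \<times> 'a) \<Rightarrow> real"
  assumes "determined_by n F"
  shows "integrable law F"
proof -
  interpret prob_space law by (rule prob_space_law)
  have "integrable law (\<lambda>\<omega>. \<Sum>x\<in>PiE {..<n} (\<lambda>_. S \<times> A).
      F x * indicator {\<omega> \<in> space law. \<forall>k<n. \<omega> k = x k} \<omega>)"
    by (intro Bochner_Integration.integrable_sum integrable_mult_right integrable_real_indicator) (auto simp: emeasure_eq_measure)
  then show ?thesis
    using determined_by_expand[OF assms] by (subst Bochner_Integration.integrable_cong[OF refl]) auto
qed

lemma weight_nonneg: "0 \<le> weight n x"
  by (simp add: weight_def prod_nonneg)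

lemma expectation_determined_by:
  fixes F :: "(nat \<Rightarrow> 's \<times> 'a) \<Rightarrow> real"
  assumes "determined_by n F"
  shows "(\<integral>\<omega>. F \<omega> \<partial>law) = (\<Sum>x\<in>PiE {..<n} (\<lambda>_. S \<times> A). F x * weight n x)"
proof -
  interpret prob_space law by (rule prob_space_law)
  have "(\<integral>\<omega>. F \<omega> \<partial>law) = (\<integral>\<omega>. (\<Sum>x\<in>PiE {..<n} (\<lambda>_. S \<times> A).
      F x * indicator {\<omega> \<in> space law. \<forall>k<n. \<omega> k = x k} \<omega>) \<partial>law)"
    by (intro Bochner_Integration.integral_cong refl determined_by_expand[OF assms])
  also have "\<dots> = (\<Sum>x\<in>PiE {..<n} (\<lambda>_. S \<times> A). F x * prob {\<omega> \<in> space law. \<forall>k<n. \<omega> k = x k})"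
    by (subst Bochner_Integration.integral_sum)
      (auto intro!: integrable_mult_right integrable_real_indicator sum.cong simp: emeasure_eq_measure)
  also have "\<dots> = (\<Sum>x\<in>PiE {..<n} (\<lambda>_. S \<times> A). F x * weight n x)"
  proof (intro sum.cong refl)
    fix x assume "x \<in> PiE {..<n} (\<lambda>_. S \<times> A)"
    then have "\<And>k. k < n \<Longrightarrow> x k \<in> S \<times> A" by (auto simp: PiE_def)
    from emeasure_prefix[OF this]
    have "prob {\<omega> \<in> space law. \<forall>k<n. \<omega> k = x k} = weight n x"
      by (simp add: measure_def weight_nonneg)
    then show "F x * prob {\<omega> \<in> space law. \<forall>k<n. \<omega> k = x k} = F x * weight n x" by simp
  qed
  finally show ?thesis .
qed

text \<open>
  The Markov property in integrated form: given the past, the pair at time \<open>t\<close> is distributed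
  according to the step distribution.
\<close>

lemma expectation_step:
  fixes F :: "(nat \<Rightarrow> 's \<times> 'a) \<Rightarrow> real" and \<phi> :: "'s \<times> 'a \<Rightarrow> real"
  assumes F: "determined_by t F"
  shows "(\<integral>\<omega>. F \<omega> * \<phi> (\<omega> t) \<partial>law) = (\<integral>\<omega>. F \<omega> * measure_pmf.expectation (step t \<omega>) \<phi> \<partial>law)"
proof -
  have d1: "determined_by (Suc t) (\<lambda>\<omega>. F \<omega> * \<phi> (\<omega> t))"
    by (rule determined_byI) (use determined_byD[OF F] in \<open>metis less_Suc_eq\<close>)
  have d2: "determined_by t (\<lambda>\<omega>. F \<omega> * measure_pmf.expectation (step t \<omega>) \<phi>)"
    by (rule determined_byI) (use determined_byD[OF F] determined_byD[OF step_adapted] in metis)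
  have upd: "F (x(t := z)) = F x" "step t (x(t := z)) = step t x" "weight t (x(t := z)) = weight t x"
    for x z
    by (rule determined_byD[OF F] determined_byD[OF step_adapted] determined_byD[OF weight_adapted],
        simp)+
  have inj: "inj_on (\<lambda>(z, x). x(t := z)) ((S \<times> A) \<times> PiE {..<t} (\<lambda>_. S \<times> A))"
    using inj_combinator[of t "{..<t}" "\<lambda>_. S \<times> A"] by (simp add: case_prod_unfold)
  have "(\<integral>\<omega>. F \<omega> * \<phi> (\<omega> t) \<partial>law) =
      (\<Sum>x\<in>PiE (insert t {..<t}) (\<lambda>_. S \<times> A). F x * \<phi> (x t) * weight (Suc t) x)"
    using expectation_determined_by[OF d1] by (simp add: lessThan_Suc)
  also have "\<dots> = (\<Sum>(z, x)\<in>(S \<times> A) \<times> PiE {..<t} (\<lambda>_. S \<times> A).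
      F x * \<phi> z * (weight t x * pmf (step t x) z))"
    unfolding PiE_insert_eq sum.reindex[OF inj]
  proof (intro sum.cong refl)
    fix q assume "q \<in> (S \<times> A) \<times> PiE {..<t} (\<lambda>_. S \<times> A)"
    obtain z x where q: "q = (z, x)" by (cases q)
    have "weight (Suc t) (x(t := z)) = weight t (x(t := z)) * pmf (step t (x(t := z))) z"
      by (simp add: weight_def)
    then show "((\<lambda>x. F x * \<phi> (x t) * weight (Suc t) x) \<circ> (\<lambda>(y, g). g(t := y))) q =
        (case q of (z, x) \<Rightarrow> F x * \<phi> z * (weight t x * pmf (step t x) z))"
      by (simp add: q upd)
  qed
  also have "\<dots> = (\<Sum>x\<in>PiE {..<t} (\<lambda>_. S \<times> A). \<Sum>z\<in>S \<times> A.
      F x * \<phi> z * (weight t x * pmf (step t x) z))"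
    unfolding sum.cartesian_product[symmetric] by (rule sum.swap)
  also have "\<dots> = (\<Sum>x\<in>PiE {..<t} (\<lambda>_. S \<times> A).
      F x * measure_pmf.expectation (step t x) \<phi> * weight t x)"
  proof (intro sum.cong refl)
    fix x assume "x \<in> PiE {..<t} (\<lambda>_. S \<times> A)"
    then have "set_pmf (step t x) \<subseteq> S \<times> A" by (intro set_step) auto
    then have "measure_pmf.expectation (step t x) \<phi> = (\<Sum>z\<in>S \<times> A. \<phi> z * pmf (step t x) z)"
      by (intro integral_measure_pmf_real[OF finite_E]) auto
    then show "(\<Sum>z\<in>S \<times> A. F x * \<phi> z * (weight t x * pmf (step t x) z)) =
        F x * measure_pmf.expectation (step t x) \<phi> * weight t x"
      by (simp add: sum_distrib_left sum_distrib_right mult_ac)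
  qed
  also have "\<dots> = (\<integral>\<omega>. F \<omega> * measure_pmf.expectation (step t \<omega>) \<phi> \<partial>law)"
    using expectation_determined_by[OF d2] by simp
  finally show ?thesis .
qed

text \<open>
  The prefix cylinders together with the empty set are stable under intersection, because of two
  cylinders either the longer is contained in the shorter or they are disjoint. They generate the
  product \<open>\<sigma>\<close>-algebra, so they determine a probability measure.
\<close>

lemma law_eqI:
  assumes M: "prob_space M" and sets_M: "sets M = sets law"
    and prefix: "\<And>n x. (\<And>k. k < n \<Longrightarrow> x k \<in> S \<times> A) \<Longrightarrow>
      emeasure M {\<omega> \<in> space law. \<forall>k<n. \<omega> k = x k} = ennreal (weight n x)"
  shows "M = law"
proof -
  let ?cyl = "\<lambda>(n, x). {\<omega> \<in> space law. \<forall>k<n. \<omega> k = x k}"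
  let ?I = "{(n::nat, x). \<forall>k<n. x k \<in> S \<times> A}"
  let ?G = "insert {} (?cyl ` ?I)"
  interpret M: prob_space M by (rule M)
  have space_M: "space M = space law" by (rule sets_eq_imp_space_eq[OF sets_M])
  have sets_gen: "sets law = sigma_sets (space law) ?G"
  proof (rule antisym)
    have "?G \<subseteq> sets law" by auto
    then show "sigma_sets (space law) ?G \<subseteq> sets law"
      by (rule sets.sigma_sets_subset)
    have coord: "{\<omega> \<in> space law. \<omega> k \<in> B} \<in> sigma_sets (space law) ?G" for k B
    proof -
      interpret sigma_algebra "space law" "sigma_sets (space law) ?G"
        by (rule sigma_algebra_sigma_sets) auto
      \<comment> \<open>A constraint on one coordinate is a finite union of cylinders up to that coordinate.\<close>
      let ?X = "{x \<in> PiE {..<Suc k} (\<lambda>_. S \<times> A). x k \<in> B}"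
      have "{\<omega> \<in> space law. \<omega> k \<in> B} = (\<Union>x\<in>?X. ?cyl (Suc k, x))"
      proof (intro set_eqI iffI)
        fix \<omega> assume \<omega>: "\<omega> \<in> {\<omega> \<in> space law. \<omega> k \<in> B}"
        then have "restrict \<omega> {..<Suc k} \<in> ?X" using in_space_law by auto
        moreover have "\<omega> \<in> ?cyl (Suc k, restrict \<omega> {..<Suc k})" using \<omega> by auto
        ultimately show "\<omega> \<in> (\<Union>x\<in>?X. ?cyl (Suc k, x))" by blast
      qed auto
      moreover have "(\<Union>x\<in>?X. ?cyl (Suc k, x)) \<in> sigma_sets (space law) ?G"
      proof (rule finite_UN)
        show "finite ?X" using finite_prefixes by simp
        show "?cyl (Suc k, x) \<in> sigma_sets (space law) ?G" if "x \<in> ?X" for x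
          by (rule sigma_sets.Basic) (use that in \<open>auto intro!: image_eqI[of _ _ "(Suc k, x)"]\<close>)
      qed
      ultimately show ?thesis by simp
    qed
    show "sets law \<subseteq> sigma_sets (space law) ?G"
    proof -
      have "sets law = sigma_sets (space law) {{\<omega> \<in> space law. \<omega> k \<in> B} | k B. k \<in> UNIV \<and> B \<in> Pow (S \<times> A)}"
        by (simp add: sets_law sets_PiM_single space_law)
      also have "\<dots> \<subseteq> sigma_sets (space law) ?G"
        by (rule sigma_sets_mono) (use coord in auto)
      finally show ?thesis .
    qed
  qed
  show ?thesis
  proof (rule measure_eqI_generator_eq[where E="?G" and \<Omega>="space law" and A="\<lambda>_. space law"])
    show "Int_stable ?G"
    proof (rule Int_stableI)
      have *: "?cyl (n, x) \<inter> ?cyl (m, y) \<in> ?G" if "n \<le> m" "(n, x) \<in> ?I" "(m, y) \<in> ?I" for n m x y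
      proof (cases "\<forall>k<n. x k = y k")
        case True
        then have "?cyl (n, x) \<inter> ?cyl (m, y) = ?cyl (m, y)" using that by auto
        then show ?thesis using that by blast
      next
        case False
        then have "?cyl (n, x) \<inter> ?cyl (m, y) = {}" using that by force
        then show ?thesis by simp
      qed
      fix a b assume "a \<in> ?G" "b \<in> ?G"
      then consider "a = {} \<or> b = {}"
        | n x m y where "a = ?cyl (n, x)" "b = ?cyl (m, y)" "(n, x) \<in> ?I" "(m, y) \<in> ?I"
        unfolding insert_iff image_iff Bex_def by (metis (no_types, lifting) prod.exhaust)
      then show "a \<inter> b \<in> ?G"
      proof cases
        case 2
        show ?thesis
        proof (cases "n \<le> m")
          case True
          then show ?thesis using *[OF True 2(3,4)] unfolding 2(1,2) by simp
        next
          case False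
          then have "m \<le> n" by simp
          from *[OF this 2(4,3)] show ?thesis unfolding 2(1,2) by (subst Int_commute)
        qed
      qed auto
    qed
    show "?G \<subseteq> Pow (space law)" by auto
    show "emeasure M X = emeasure law X" if X: "X \<in> ?G" for X
    proof -
      consider "X = {}" | n x where "X = ?cyl (n, x)" "\<And>k. k < n \<Longrightarrow> x k \<in> S \<times> A"
        using X by (auto simp del: ex_simps)
      then show ?thesis
      proof cases
        case 2
        then show ?thesis using prefix[OF 2(2)] emeasure_prefix[OF 2(2)] by simp
      qed simp
    qed
    show "sets M = sigma_sets (space law) ?G" using sets_M sets_gen by simp
    show "sets law = sigma_sets (space law) ?G" by (fact sets_gen)
    show "range (\<lambda>_. space law) \<subseteq> ?G"
    proof -
      \<comment> \<open>The empty prefix imposes no condition.\<close>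
      have "?cyl (0, \<lambda>_. undefined) \<in> ?cyl ` ?I" by (rule imageI) simp
      then show ?thesis by simp
    qed
    show "(\<Union>i. space law) = space law" by simp
    show "emeasure M (space law) \<noteq> \<infinity>" for i :: nat
      by simp
  qed
qed

end

section \<open>Poisson equations of irreducible finite chains\<close>

text \<open>
  Gaussian elimination: an equation with a nonzero coefficient is used to eliminate one unknown,
  which lowers the number of equations and the number of unknowns by one.
\<close>

lemma homogeneous_system_nontrivial:
  fixes a :: "'e \<Rightarrow> 'u \<Rightarrow> real"
  assumes "finite E" "finite U" "card E < card U"
  shows "\<exists>x. (\<exists>u\<in>U. x u \<noteq> 0) \<and> (\<forall>e\<in>E. (\<Sum>u\<in>U. a e u * x u) = 0)"
  using assms
proof (induction E arbitrary: U a rule: finite_induct)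
  case empty
  then obtain u where "u \<in> U" by fastforce
  then show ?case by (intro exI[of _ "\<lambda>_. 1"]) auto
next
  case (insert e E)
  show ?case
  proof (cases "\<forall>u\<in>U. a e u = 0")
    case True
    have "card E < card U" using insert by simp
    then show ?thesis using insert.IH[of U a] insert.prems True by auto
  next
    case False
    then obtain v where v: "v \<in> U" "a e v \<noteq> 0" by blast
    let ?V = "U - {v}"
    define b where "b f u = a f u - a f v / a e v * a e u" for f u
    have "card E < card ?V" using insert v by simp
    then obtain x where x: "\<exists>u\<in>?V. x u \<noteq> 0" "\<forall>f\<in>E. (\<Sum>u\<in>?V. b f u * x u) = 0"
      using insert.IH[of ?V b] insert.prems by auto
    define c where "c = - (\<Sum>u\<in>?V. a e u * x u) / a e v"
    define y where "y = x(v := c)"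
    have split: "(\<Sum>u\<in>U. a f u * y u) = a f v * c + (\<Sum>u\<in>?V. a f u * x u)" for f
      using sum.remove[OF insert.prems(1) v(1), of "\<lambda>u. a f u * y u"]
      by (simp add: y_def)
    have "(\<Sum>u\<in>U. a e u * y u) = 0"
      unfolding split c_def using v by simp
    moreover have "(\<Sum>u\<in>U. a f u * y u) = 0" if "f \<in> E" for f
    proof -
      have "0 = (\<Sum>u\<in>?V. a f u * x u) - a f v / a e v * (\<Sum>u\<in>?V. a e u * x u)"
        using x(2) that by (simp add: b_def left_diff_distrib sum_subtractf sum_distrib_left mult.assoc)
      then show ?thesis unfolding split c_def by (simp add: algebra_simps)
    qed
    moreover have "\<exists>u\<in>U. y u \<noteq> 0" using x(1) by (auto simp: y_def)
    ultimately show ?thesis by (intro exI[of _ y]) auto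
  qed
qed

text \<open>
  The inhomogeneous system becomes homogeneous with one further unknown, the coefficient of the
  right-hand side. Injectivity forces that unknown to be nonzero in a nontrivial solution, so that
  one can divide by it.
\<close>

lemma injective_system_solvable:
  fixes a :: "'u \<Rightarrow> 'u \<Rightarrow> real"
  assumes "finite U"
    and inj: "\<And>x. (\<And>e. e \<in> U \<Longrightarrow> (\<Sum>u\<in>U. a e u * x u) = 0) \<Longrightarrow> (\<And>u. u \<in> U \<Longrightarrow> x u = 0)"
  shows "\<exists>x. \<forall>e\<in>U. (\<Sum>u\<in>U. a e u * x u) = b e"
proof -
  define a' where "a' e w = (case w of None \<Rightarrow> - b e | Some u \<Rightarrow> a e u)" for e w
  let ?W = "insert None (Some ` U)"
  have sum_W: "(\<Sum>w\<in>?W. a' e w * x w) = (\<Sum>u\<in>U. a e u * x (Some u)) - b e * x None" for e x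
    using assms(1) by (subst sum.insert) (auto simp: sum.reindex a'_def)
  have "card U < card ?W" using assms(1) by (simp add: card_image)
  then obtain x where x: "\<exists>w\<in>?W. x w \<noteq> 0" "\<forall>e\<in>U. (\<Sum>w\<in>?W. a' e w * x w) = 0"
    using homogeneous_system_nontrivial[of U ?W a'] assms(1) by auto
  have eq: "(\<Sum>u\<in>U. a e u * x (Some u)) = b e * x None" if "e \<in> U" for e
    using x(2) that by (simp only: sum_W) simp
  have "x None \<noteq> 0"
  proof
    assume "x None = 0"
    then have "x (Some u) = 0" if "u \<in> U" for u
      using inj[of "\<lambda>u. x (Some u)"] eq that by simp
    then show False using x(1) \<open>x None = 0\<close> by auto
  qed
  then have sol: "(\<Sum>u\<in>U. a e u * (x (Some u) / x None)) = b e" if "e \<in> U" for e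
  proof -
    have "(\<Sum>u\<in>U. a e u * (x (Some u) / x None)) = (\<Sum>u\<in>U. a e u * x (Some u)) / x None"
      by (simp add: sum_divide_distrib)
    then show ?thesis using eq[OF that] \<open>x None \<noteq> 0\<close> by simp
  qed
  show ?thesis
    by (intro exI[of _ "\<lambda>u. x (Some u) / x None"] ballI sol)
qed

locale finite_chain =
  fixes S :: "'s set" and K :: "'s \<Rightarrow> 's pmf"
  assumes finite: "finite S" and nonempty: "S \<noteq> {}"
    and closed: "\<And>s. s \<in> S \<Longrightarrow> set_pmf (K s) \<subseteq> S"
    and irreducible: "irreducible_chain S K"
begin

abbreviation next_mean :: "('s \<Rightarrow> real) \<Rightarrow> 's \<Rightarrow> real" where
  "next_mean h s \<equiv> measure_pmf.expectation (K s) h"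

lemma next_mean_sum: "s \<in> S \<Longrightarrow> next_mean h s = (\<Sum>s'\<in>S. pmf (K s) s' * h s')"
  using integral_measure_pmf_real[OF finite, of "K s" h] closed by (auto simp: mult.commute)

lemma sum_pmf: "s \<in> S \<Longrightarrow> (\<Sum>s'\<in>S. pmf (K s) s') = 1"
  using sum_pmf_eq_1[OF finite closed] by simp

text \<open>
  The minimum principle: at a minimiser, the mean over the successors is at most the minimum, so all
  successors are minimisers, and by irreducibility every state is reached.
\<close>

lemma superharmonic_constant:
  assumes super: "\<And>s. s \<in> S \<Longrightarrow> next_mean w s \<le> w s"
    and "s \<in> S" "s' \<in> S"
  shows "w s = w s'"
proof -
  obtain x where x: "x \<in> S" "\<And>s. s \<in> S \<Longrightarrow> w x \<le> w s"
  proof -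
    have "Min (w ` S) \<in> w ` S" using finite nonempty by simp
    then obtain x where "x \<in> S" "w x = Min (w ` S)" by auto
    then show ?thesis using that finite by simp
  qed
  let ?Z = "{s \<in> S. w s = w x}"
  have step: "set_pmf (K s) \<subseteq> ?Z" if s: "s \<in> ?Z" for s
  proof
    fix y assume y: "y \<in> set_pmf (K s)"
    have sS: "s \<in> S" "w s = w x" and yS: "y \<in> S" using s y closed by auto
    have "(\<Sum>s'\<in>S. pmf (K s) s' * (w s' - w x)) = next_mean w s - w x"
      using sS by (simp add: next_mean_sum right_diff_distrib sum_subtractf sum_distrib_right[symmetric] sum_pmf)
    then have "(\<Sum>s'\<in>S. pmf (K s) s' * (w s' - w x)) \<le> 0" using super[of s] sS by simp
    moreover have nn: "\<And>s'. s' \<in> S \<Longrightarrow> 0 \<le> pmf (K s) s' * (w s' - w x)" using x(2) by simp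
    ultimately have "(\<Sum>s'\<in>S. pmf (K s) s' * (w s' - w x)) = 0"
      by (intro antisym sum_nonneg)
    then have "pmf (K s) y * (w y - w x) = 0"
      using sum_nonneg_eq_0_iff[OF finite nn] yS by simp
    then show "y \<in> ?Z" using y yS by (simp add: set_pmf_iff)
  qed
  have reach: "set_pmf (nstep K k x) \<subseteq> ?Z" for k
    by (induction k) (use x step in fastforce)+
  have "w y = w x" if yS: "y \<in> S" for y
  proof -
    obtain k where "pmf (nstep K k x) y > 0"
      using irreducible[unfolded irreducible_chain_def, rule_format, OF x(1) yS] by blast
    then have "y \<in> set_pmf (nstep K k x)" by (simp add: set_pmf_iff)
    then show ?thesis using reach by blast
  qed
  then show ?thesis using assms by metis
qed

text \<open>
  The operator \<open>I - K\<close> kills the constants, so it cannot be inverted directly. Adding the rank-one term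
  \<open>h \<mapsto> h x\<close> for a fixed state \<open>x\<close> makes it injective, hence surjective, and in a solution the value
  \<open>h x\<close> is the gain \<open>\<rho>\<close>.
\<close>

lemma poisson_equation:
  fixes r :: "'s \<Rightarrow> real"
  shows "\<exists>\<rho> h. \<forall>s\<in>S. r s = \<rho> + h s - next_mean h s"
proof -
  obtain x where x: "x \<in> S" using nonempty by blast
  define a where "a s s' = (if s' = s then 1 else 0) - pmf (K s) s' + (if s' = x then 1 else 0)" for s s'
  have a: "(\<Sum>s'\<in>S. a s s' * h s') = h s - next_mean h s + h x" if "s \<in> S" for s h
  proof -
    have "(\<Sum>s'\<in>S. a s s' * h s') = (\<Sum>s'\<in>S. (if s' = s then h s' else 0) - pmf (K s) s' * h s' + (if s' = x then h s' else 0))"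
      by (intro sum.cong refl) (auto simp: a_def algebra_simps)
    also have "\<dots> = h s - next_mean h s + h x"
      using that x finite by (simp add: sum.distrib sum_subtractf next_mean_sum)
    finally show ?thesis .
  qed
  have "\<exists>h. \<forall>s\<in>S. (\<Sum>s'\<in>S. a s s' * h s') = r s"
  proof (rule injective_system_solvable[OF finite])
    fix h s assume zero: "\<And>s. s \<in> S \<Longrightarrow> (\<Sum>s'\<in>S. a s s' * h s') = 0" and s: "s \<in> S"
    have eq: "next_mean h s = h s + h x" if "s \<in> S" for s
      using zero[OF that] a[OF that, of h] by simp
    \<comment> \<open>Depending on the sign of \<open>h x\<close>, either \<open>h\<close> or \<open>- h\<close> is superharmonic.\<close>
    have const: "h s = h x" if "s \<in> S" for s
    proof (cases "h x \<le> 0")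
      case True
      show ?thesis
        by (rule superharmonic_constant[OF _ that x]) (use eq True in simp)
    next
      case False
      have "- h s = - h x"
        by (rule superharmonic_constant[of "\<lambda>s. - h s", OF _ that x]) (use eq False in simp)
      then show ?thesis by simp
    qed
    have "next_mean h x = (\<Sum>s'\<in>S. pmf (K x) s' * h x)"
      unfolding next_mean_sum[OF x] by (intro sum.cong refl) (use const in simp)
    also have "\<dots> = h x" using sum_pmf[OF x] by (simp add: sum_distrib_right[symmetric])
    finally have "h x = 0" using eq[OF x] by simp
    then show "h s = 0" using const s by simp
  qed
  then obtain h where "\<forall>s\<in>S. (\<Sum>s'\<in>S. a s s' * h s') = r s" by blast
  then have "r s = h x + h s - next_mean h s" if "s \<in> S" for s
    using a[OF that, of h] that by simp
  then show ?thesis by blast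
qed

end

section \<open>The average cost optimality inequality\<close>

locale irreducible_mdp =
  fixes S :: "'s set" and A :: "'a set" and p :: "'s \<Rightarrow> 'a \<Rightarrow> 's pmf"
  assumes finite_S: "finite S" and S_nonempty: "S \<noteq> {}"
    and finite_A: "finite A" and A_nonempty: "A \<noteq> {}"
    and closed: "\<And>s a. s \<in> S \<Longrightarrow> a \<in> A \<Longrightarrow> set_pmf (p s a) \<subseteq> S"
    and irreducible: "\<And>f. f \<in> S \<rightarrow> A \<Longrightarrow> irreducible_chain S (\<lambda>s. p s (f s))"
begin

lemma finite_chain: "f \<in> S \<rightarrow> A \<Longrightarrow> finite_chain S (\<lambda>s. p s (f s))"
  by unfold_locales (use finite_S S_nonempty closed irreducible in auto)

text \<open>
  The Poisson equation of the stationary policy \<open>f\<close> for the cost \<open>c\<close>: \<open>g\<close> is the gain, that is the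
  long-run average cost, and \<open>h\<close> the bias.
\<close>

definition evaluates :: "('s \<Rightarrow> 'a \<Rightarrow> real) \<Rightarrow> ('s \<Rightarrow> 'a) \<Rightarrow> real \<Rightarrow> ('s \<Rightarrow> real) \<Rightarrow> bool" where
  "evaluates c f g h \<longleftrightarrow>
    (\<forall>s\<in>S. c s (f s) = g + h s - measure_pmf.expectation (p s (f s)) h)"

lemma evaluates_exists: "f \<in> S \<rightarrow> A \<Longrightarrow> \<exists>g h. evaluates c f g h"
  unfolding evaluates_def using finite_chain.poisson_equation[OF finite_chain, of f "\<lambda>s. c s (f s)"] by simp

text \<open>
  Howard's policy improvement, used once. Take a policy \<open>f\<close> of minimal gain among the finitely many
  stationary ones. If the inequality failed for some \<open>s\<close> and \<open>a\<close>, let \<open>f'\<close> play \<open>a\<close> in \<open>s\<close> and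
  agree with \<open>f\<close> elsewhere. As the gain of \<open>f'\<close> is not smaller, the difference of the two biases
  is superharmonic for the chain of \<open>f'\<close>, strictly so at \<open>s\<close>, which contradicts the minimum
  principle.
\<close>

lemma optimality_inequality:
  "\<exists>f\<in>S \<rightarrow>\<^sub>E A. \<exists>g h. evaluates c f g h \<and>
    (\<forall>s\<in>S. \<forall>a\<in>A. g + h s \<le> c s a + measure_pmf.expectation (p s a) h)"
proof -
  let ?F = "S \<rightarrow>\<^sub>E A"
  have fin: "finite ?F" using finite_S finite_A by (intro finite_PiE) auto
  have "?F \<noteq> {}" using A_nonempty by (simp add: PiE_eq_empty_iff)
  have "\<forall>f\<in>?F. \<exists>gh. evaluates c f (fst gh) (snd gh)"
    using evaluates_exists by (auto simp: PiE_def)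
  then obtain gh where gh: "\<And>f. f \<in> ?F \<Longrightarrow> evaluates c f (fst (gh f)) (snd (gh f))"
    by metis
  define f where "f = arg_min_on (\<lambda>f. fst (gh f)) ?F"
  have f: "f \<in> ?F" and f_min: "\<And>f'. f' \<in> ?F \<Longrightarrow> fst (gh f) \<le> fst (gh f')"
    unfolding f_def using arg_min_if_finite[OF fin \<open>?F \<noteq> {}\<close>, of "\<lambda>f. fst (gh f)"]
    by (auto simp: arg_min_least[OF fin \<open>?F \<noteq> {}\<close>])
  define g h where "g = fst (gh f)" and "h = snd (gh f)"
  have ev: "evaluates c f g h" using gh[OF f] by (simp add: g_def h_def)
  have "g + h s \<le> c s a + measure_pmf.expectation (p s a) h" if s: "s \<in> S" and a: "a \<in> A" for s a
  proof (rule ccontr)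
    assume "\<not> ?thesis"
    then have better: "c s a + measure_pmf.expectation (p s a) h < g + h s" by simp
    define f' where "f' = f(s := a)"
    have f': "f' \<in> ?F" using f s a by (auto simp: f'_def PiE_def extensional_def)
    then have f'_Pi: "f' \<in> S \<rightarrow> A" by auto
    interpret C: finite_chain S "\<lambda>s. p s (f' s)" by (rule finite_chain[OF f'_Pi])
    define g' h' where "g' = fst (gh f')" and "h' = snd (gh f')"
    define w where "w x = h x - h' x" for x
    have ev': "c x (f' x) = g' + h' x - C.next_mean h' x" if "x \<in> S" for x
      using gh[OF f'] that by (simp add: evaluates_def g'_def h'_def)
    have "g \<le> g'" using f_min[OF f'] by (simp add: g_def g'_def)
    have le: "c x (f' x) + C.next_mean h x \<le> g + h x" if "x \<in> S" for x
      using ev better that by (auto simp: evaluates_def f'_def)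
    have mean_w: "C.next_mean w x = C.next_mean h x - C.next_mean h' x" if "x \<in> S" for x
      unfolding w_def using that
      by (simp add: C.next_mean_sum right_diff_distrib sum_subtractf)
    have "C.next_mean w x \<le> w x" if "x \<in> S" for x
      using le[OF that] ev'[OF that] mean_w[OF that] \<open>g \<le> g'\<close> by (simp add: w_def)
    then have const: "w x = w s" if "x \<in> S" for x
      by (intro C.superharmonic_constant that s)
    have "C.next_mean w s = (\<Sum>x\<in>S. pmf (p s (f' s)) x * w s)"
      unfolding C.next_mean_sum[OF s] by (intro sum.cong refl) (use const in simp)
    also have "\<dots> = w s" using C.sum_pmf[OF s] by (simp add: sum_distrib_right[symmetric])
    finally have "C.next_mean w s = w s" .
    moreover have "C.next_mean w s < w s"
      using better ev'[OF s] mean_w[OF s] \<open>g \<le> g'\<close> by (simp add: w_def f'_def)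
    ultimately show False by simp
  qed
  then show ?thesis using f ev by blast
qed

end

section \<open>Long-run averages along controlled processes\<close>

text \<open>
  The odd term \<open>4 m x\<^sup>3\<close> of the binomial expansion is absorbed by \<open>2 m\<^sup>2 x\<^sup>2 + 2 x\<^sup>4\<close>, while the term linear
  in \<open>x\<close> is kept because it has mean zero for a martingale increment \<open>x\<close>.
\<close>

lemma fourth_power_increment:
  fixes m x b :: real
  assumes "\<bar>x\<bar> \<le> b"
  shows "(m + x) ^ 4 \<le> m ^ 4 + 4 * (m ^ 3 * x) + 8 * b\<^sup>2 * m\<^sup>2 + 3 * b ^ 4"
proof -
  have b: "x\<^sup>2 \<le> b\<^sup>2" using power_mono[OF assms abs_ge_zero, of 2] by (simp only: power2_abs)
  \<comment> \<open>This is the bound \<open>4 m x\<^sup>3 \<le> 2 m\<^sup>2 x\<^sup>2 + 2 x\<^sup>4\<close>.\<close>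
  have "0 \<le> 2 * (x\<^sup>2 * (m - x)\<^sup>2)" by simp
  then have "(m + x) ^ 4 \<le> m ^ 4 + 4 * (m ^ 3 * x) + 8 * (x\<^sup>2 * m\<^sup>2) + 3 * (x\<^sup>2)\<^sup>2"
    by (simp add: power4_eq_xxxx power3_eq_cube power2_eq_square algebra_simps)
  also have "x\<^sup>2 * m\<^sup>2 \<le> b\<^sup>2 * m\<^sup>2" using b by (intro mult_right_mono) auto
  also have "(x\<^sup>2)\<^sup>2 \<le> (b\<^sup>2)\<^sup>2" by (rule power_mono[OF b]) simp
  finally show ?thesis by (simp add: mult_ac)
qed

lemma convergent_averages_lim: "convergent (averages x) \<Longrightarrow> averages x \<longlonglongrightarrow> lim (averages x)"
  by (simp add: convergent_LIMSEQ_iff)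

lemma averages_bounded:
  assumes "\<And>t. \<bar>x t\<bar> \<le> b"
  shows "\<bar>averages x T\<bar> \<le> b"
proof (cases "T = 0")
  case True
  then show ?thesis using assms[of 0] by (simp add: averages_def)
next
  case False
  have "\<bar>\<Sum>t<T. x t\<bar> \<le> (\<Sum>t<T. \<bar>x t\<bar>)" by (rule sum_abs)
  also have "\<dots> \<le> real T * b"
    using sum_bounded_above[of "{..<T}" "\<lambda>t. \<bar>x t\<bar>" b] assms by simp
  finally show ?thesis using False by (simp add: averages_def abs_mult field_simps)
qed

context controlled_process
begin

lemma expectation_next_state:
  fixes F :: "(nat \<Rightarrow> 's \<times> 'a) \<Rightarrow> real" and h :: "'s \<Rightarrow> real"
  assumes "determined_by (Suc t) F"
  shows "(\<integral>\<omega>. F \<omega> * h (fst (\<omega> (Suc t))) \<partial>law) =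
    (\<integral>\<omega>. F \<omega> * measure_pmf.expectation (p (fst (\<omega> t)) (snd (\<omega> t))) h \<partial>law)"
proof -
  have "map_pmf fst (step (Suc t) \<omega>) = p (fst (\<omega> t)) (snd (\<omega> t))" for \<omega>
    by (simp add: step_pmf_def map_bind_pmf map_pmf_comp bind_return_pmf')
  then have "measure_pmf.expectation (step (Suc t) \<omega>) (\<lambda>z. h (fst z)) =
      measure_pmf.expectation (p (fst (\<omega> t)) (snd (\<omega> t))) h" for \<omega>
    using integral_map_pmf[of fst "step (Suc t) \<omega>" h] by simp
  then show ?thesis
    using expectation_step[OF assms, of "\<lambda>z. h (fst z)"] by simp
qed

lemma coordinate_determined: "determined_by (Suc t) (\<lambda>\<omega>. \<phi> (\<omega> t))"
  by (rule determined_byI) simp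

lemma coordinate_integrable: "integrable law (\<lambda>\<omega>. \<phi> (\<omega> t) :: real)"
  by (rule determined_by_integrable) (rule coordinate_determined)

lemma coordinate_measurable [measurable]: "(\<lambda>\<omega>. \<phi> (\<omega> t) :: real) \<in> borel_measurable law"
  by (rule determined_by_measurable) (rule coordinate_determined)

lemma coordinate_bounded: "\<exists>b. \<forall>\<omega>\<in>space law. \<forall>t. \<bar>\<phi> (\<omega> t) :: real\<bar> \<le> b"
proof (intro exI ballI allI)
  fix \<omega> t assume "\<omega> \<in> space law"
  then show "\<bar>\<phi> (\<omega> t)\<bar> \<le> (\<Sum>z\<in>S \<times> A. \<bar>\<phi> z\<bar>)"
    by (intro member_le_sum[of _ _ "\<lambda>z. \<bar>\<phi> z\<bar>"] in_space_law finite_E) auto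
qed

lemma averages_measurable [measurable]:
  "(\<lambda>\<omega>. averages (\<lambda>t. \<phi> (\<omega> t)) T) \<in> borel_measurable law"
  unfolding averages_def by measurable

lemma lim_averages_measurable [measurable]:
  "(\<lambda>\<omega>. lim (averages (\<lambda>t. \<phi> (\<omega> t)))) \<in> borel_measurable law"
  by (rule borel_measurable_lim_metric) measurable

text \<open>
  Where the averages diverge, \<open>lim\<close> is an unspecified constant. This happens only on a null set,
  and elsewhere the averages are bounded, so dominated convergence applies.
\<close>

lemma lim_averages_integral:
  assumes conv: "AE \<omega> in law. convergent (averages (\<lambda>t. \<phi> (\<omega> t)))"
  shows "integrable law (\<lambda>\<omega>. lim (averages (\<lambda>t. \<phi> (\<omega> t))))"
    and "(\<lambda>T. \<integral>\<omega>. averages (\<lambda>t. \<phi> (\<omega> t)) T \<partial>law) \<longlonglongrightarrow>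
      (\<integral>\<omega>. lim (averages (\<lambda>t. \<phi> (\<omega> t))) \<partial>law)"
proof -
  interpret prob_space law by (rule prob_space_law)
  obtain b where b: "\<And>\<omega> t. \<omega> \<in> space law \<Longrightarrow> \<bar>\<phi> (\<omega> t)\<bar> \<le> b"
    using coordinate_bounded[of \<phi>] by blast
  have lim: "AE \<omega> in law. averages (\<lambda>t. \<phi> (\<omega> t)) \<longlonglongrightarrow> lim (averages (\<lambda>t. \<phi> (\<omega> t)))"
    using conv by eventually_elim (rule convergent_averages_lim)
  have bound: "AE \<omega> in law. norm (averages (\<lambda>t. \<phi> (\<omega> t)) T) \<le> b" for T
    using b by (intro AE_I2) (auto intro: averages_bounded)
  note dom = lim_averages_measurable averages_measurable integrable_const lim bound
  show "integrable law (\<lambda>\<omega>. lim (averages (\<lambda>t. \<phi> (\<omega> t))))"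
    by (rule integrable_dominated_convergence[OF dom])
  show "(\<lambda>T. \<integral>\<omega>. averages (\<lambda>t. \<phi> (\<omega> t)) T \<partial>law) \<longlonglongrightarrow>
      (\<integral>\<omega>. lim (averages (\<lambda>t. \<phi> (\<omega> t))) \<partial>law)"
    by (rule integral_dominated_convergence[OF dom])
qed

text \<open>
  Taking expectations in the inequality at time \<open>t\<close> turns the last term into the expectation of \<open>h\<close>
  at time \<open>t + 1\<close>. The sum over \<open>t\<close> therefore telescopes, and the boundary terms are bounded and
  vanish after division by the horizon.
\<close>

lemma gain_lower_bound:
  assumes ineq: "\<And>s a. s \<in> S \<Longrightarrow> a \<in> A \<Longrightarrow>
      g + h s \<le> c (s, a) + measure_pmf.expectation (p s a) h"
    and conv: "AE \<omega> in law. convergent (averages (\<lambda>t. c (\<omega> t)))"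
  shows "g \<le> (\<integral>\<omega>. lim (averages (\<lambda>t. c (\<omega> t))) \<partial>law)"
proof -
  interpret prob_space law by (rule prob_space_law)
  define H where "H t = (\<integral>\<omega>. h (fst (\<omega> t)) \<partial>law)" for t
  obtain b where b: "\<And>\<omega> t. \<omega> \<in> space law \<Longrightarrow> \<bar>h (fst (\<omega> t))\<bar> \<le> b"
    using coordinate_bounded[of "\<lambda>z. h (fst z)"] by blast
  have H_bound: "\<bar>H t\<bar> \<le> b" for t
  proof -
    have "\<bar>H t\<bar> \<le> (\<integral>\<omega>. \<bar>h (fst (\<omega> t))\<bar> \<partial>law)" unfolding H_def by (rule integral_abs_bound)
    also have "\<dots> \<le> (\<integral>\<omega>. b \<partial>law)"
      by (rule integral_mono) (use b coordinate_integrable[of "\<lambda>z. \<bar>h (fst z)\<bar>"] in auto)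
    finally show ?thesis by (simp add: prob_space)
  qed
  have one: "g + H t - H (Suc t) \<le> (\<integral>\<omega>. c (\<omega> t) \<partial>law)" for t
  proof -
    let ?P = "\<lambda>\<omega>. measure_pmf.expectation (p (fst (\<omega> t)) (snd (\<omega> t))) h"
    have Hs: "H (Suc t) = (\<integral>\<omega>. ?P \<omega> \<partial>law)"
      using expectation_next_state[of t "\<lambda>_. 1" h] by (simp add: H_def determined_by_def)
    note int = coordinate_integrable[of "\<lambda>z. h (fst z)" t] coordinate_integrable[of c t]
      coordinate_integrable[of "\<lambda>z. measure_pmf.expectation (p (fst z) (snd z)) h" t]
    have "(\<integral>\<omega>. g + h (fst (\<omega> t)) - ?P \<omega> \<partial>law) \<le> (\<integral>\<omega>. c (\<omega> t) \<partial>law)"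
    proof (rule integral_mono)
      fix \<omega> assume "\<omega> \<in> space law"
      then show "g + h (fst (\<omega> t)) - ?P \<omega> \<le> c (\<omega> t)"
        using in_space_law[of \<omega> t] ineq[of "fst (\<omega> t)" "snd (\<omega> t)"] by (auto simp: mem_Times_iff)
    qed (use int in auto)
    moreover have "(\<integral>\<omega>. g + h (fst (\<omega> t)) - ?P \<omega> \<partial>law) = g + H t - H (Suc t)"
      using int Hs by (simp add: prob_space H_def)
    ultimately show ?thesis by simp
  qed
  have sum: "real T * g + H 0 - H T \<le> (\<Sum>t<T. \<integral>\<omega>. c (\<omega> t) \<partial>law)" for T
  proof (induction T)
    case (Suc T)
    then show ?case using one[of T] by (simp add: algebra_simps)
  qed simp
  have avg: "g - 2 * b / real T \<le> (\<integral>\<omega>. averages (\<lambda>t. c (\<omega> t)) T \<partial>law)" if "T > 0" for T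
  proof -
    have "real T * g - 2 * b \<le> (\<Sum>t<T. \<integral>\<omega>. c (\<omega> t) \<partial>law)"
      using sum[of T] H_bound[of 0] H_bound[of T] by linarith
    then have "(real T * g - 2 * b) / real T \<le> (\<Sum>t<T. \<integral>\<omega>. c (\<omega> t) \<partial>law) / real T"
      by (rule divide_right_mono) simp
    then have "g - 2 * b / real T \<le> (1 / real T) * (\<Sum>t<T. \<integral>\<omega>. c (\<omega> t) \<partial>law)"
      using that by (simp add: diff_divide_distrib)
    also have "\<dots> = (\<integral>\<omega>. averages (\<lambda>t. c (\<omega> t)) T \<partial>law)"
      unfolding averages_def using coordinate_integrable by simp
    finally show ?thesis .
  qed
  have "(\<lambda>T. g - 2 * b / real T) \<longlonglongrightarrow> g - 0"
    by (intro tendsto_intros tendsto_divide_0[OF tendsto_const] filterlim_real_sequentially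
      filterlim_at_top_imp_at_infinity)
  then have "(\<lambda>T. g - 2 * b / real T) \<longlonglongrightarrow> g" by simp
  moreover have "\<exists>N. \<forall>T\<ge>N. g - 2 * b / real T \<le> (\<integral>\<omega>. averages (\<lambda>t. c (\<omega> t)) T \<partial>law)"
    by (intro exI[of _ 1] allI impI avg) simp
  ultimately show ?thesis
    by (rule LIMSEQ_le[OF _ lim_averages_integral(2)[OF conv]])
qed

text \<open>
  The sums \<open>M T\<close> of the martingale differences satisfy \<open>E (M T)\<^sup>2 \<le> b\<^sup>2 T\<close> by orthogonality and then
  \<open>E (M T)\<^sup>4 \<le> 7 b\<^sup>4 T\<^sup>2\<close> by the fourth power estimate. Hence the expectations of \<open>(M T / T)\<^sup>4\<close> are
  summable over \<open>T\<close>, the series of these variables is almost surely finite, and its terms tend to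
  zero. The second moments alone would only give a multiple of the harmonic series as a bound.
\<close>

lemma martingale_strong_law:
  fixes h :: "'s \<Rightarrow> real"
  defines "D \<equiv> \<lambda>t \<omega>. h (fst (\<omega> (Suc t))) -
    measure_pmf.expectation (p (fst (\<omega> t)) (snd (\<omega> t))) h"
  shows "AE \<omega> in law. (\<lambda>T. (\<Sum>t<T. D t \<omega>) / real T) \<longlonglongrightarrow> 0"
proof -
  interpret prob_space law by (rule prob_space_law)
  define M where "M T \<omega> = (\<Sum>t<T. D t \<omega>)" for T \<omega>
  have M_Suc: "M (Suc T) \<omega> = M T \<omega> + D T \<omega>" for T \<omega> by (simp add: M_def)
  have D_det: "determined_by (Suc (Suc t)) (D t)" for t
    unfolding D_def by (rule determined_byI) simp
  have M_det: "determined_by (Suc T) (M T)" for T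
    unfolding M_def D_def by (rule determined_byI) (auto intro!: sum.cong)
  have int: "integrable law (\<lambda>\<omega>. G (M T \<omega>) (D T \<omega>) :: real)" for G T
  proof (rule determined_by_integrable)
    show "determined_by (Suc (Suc T)) (\<lambda>\<omega>. G (M T \<omega>) (D T \<omega>))"
    proof (rule determined_byI)
      fix \<omega> \<omega>' :: "nat \<Rightarrow> 's \<times> 'a" assume eq: "\<And>k. k < Suc (Suc T) \<Longrightarrow> \<omega> k = \<omega>' k"
      have "M T \<omega> = M T \<omega>'" by (rule determined_byD[OF M_det]) (simp add: eq)
      moreover have "D T \<omega> = D T \<omega>'" by (rule determined_byD[OF D_det]) (simp add: eq)
      ultimately show "G (M T \<omega>) (D T \<omega>) = G (M T \<omega>') (D T \<omega>')" by simp
    qed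
  qed
  have orth: "(\<integral>\<omega>. G (M T \<omega>) * D T \<omega> \<partial>law) = 0" for G T
  proof -
    let ?P = "\<lambda>\<omega>. measure_pmf.expectation (p (fst (\<omega> T)) (snd (\<omega> T))) h"
    have G_det: "determined_by (Suc T) (\<lambda>\<omega>. G (M T \<omega>))"
    proof (rule determined_byI)
      fix \<omega> \<omega>' :: "nat \<Rightarrow> 's \<times> 'a" assume eq: "\<And>k. k < Suc T \<Longrightarrow> \<omega> k = \<omega>' k"
      have "M T \<omega> = M T \<omega>'" by (rule determined_byD[OF M_det eq])
      then show "G (M T \<omega>) = G (M T \<omega>')" by simp
    qed
    have "integrable law (\<lambda>\<omega>. G (M T \<omega>) * h (fst (\<omega> (Suc T))))"
    proof (rule determined_by_integrable, rule determined_byI)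
      fix \<omega> \<omega>' :: "nat \<Rightarrow> 's \<times> 'a" assume eq: "\<And>k. k < Suc (Suc T) \<Longrightarrow> \<omega> k = \<omega>' k"
      have "G (M T \<omega>) = G (M T \<omega>')" by (rule determined_byD[OF G_det]) (simp add: eq)
      then show "G (M T \<omega>) * h (fst (\<omega> (Suc T))) = G (M T \<omega>') * h (fst (\<omega>' (Suc T)))"
        by (simp add: eq)
    qed
    moreover have "integrable law (\<lambda>\<omega>. G (M T \<omega>) * ?P \<omega>)"
    proof (rule determined_by_integrable, rule determined_byI)
      fix \<omega> \<omega>' :: "nat \<Rightarrow> 's \<times> 'a" assume eq: "\<And>k. k < Suc T \<Longrightarrow> \<omega> k = \<omega>' k"
      have "G (M T \<omega>) = G (M T \<omega>')" by (rule determined_byD[OF G_det]) (simp add: eq)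
      then show "G (M T \<omega>) * ?P \<omega> = G (M T \<omega>') * ?P \<omega>'"
        by (simp add: eq)
    qed
    ultimately show ?thesis
      using expectation_next_state[OF G_det, of h] by (simp add: D_def right_diff_distrib)
  qed
  obtain b1 where b1: "\<And>\<omega> t. \<omega> \<in> space law \<Longrightarrow> \<bar>h (fst (\<omega> t))\<bar> \<le> b1"
    using coordinate_bounded[of "\<lambda>z. h (fst z)"] by blast
  obtain b2 where b2: "\<And>\<omega> t. \<omega> \<in> space law \<Longrightarrow>
      \<bar>measure_pmf.expectation (p (fst (\<omega> t)) (snd (\<omega> t))) h\<bar> \<le> b2"
    using coordinate_bounded[of "\<lambda>z. measure_pmf.expectation (p (fst z) (snd z)) h"] by blast
  define b where "b = b1 + b2"
  have D_bound: "\<bar>D t \<omega>\<bar> \<le> b" if "\<omega> \<in> space law" for t \<omega>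
    using b1[OF that, of "Suc t"] b2[OF that, of t] unfolding D_def b_def by linarith
  have second: "(\<integral>\<omega>. (M T \<omega>)\<^sup>2 \<partial>law) \<le> b\<^sup>2 * real T" for T
  proof (induction T)
    case 0
    then show ?case by (simp add: M_def)
  next
    case (Suc T)
    have "(\<integral>\<omega>. (M (Suc T) \<omega>)\<^sup>2 \<partial>law) \<le> (\<integral>\<omega>. (M T \<omega>)\<^sup>2 + 2 * (M T \<omega> * D T \<omega>) + b\<^sup>2 \<partial>law)"
    proof (rule integral_mono)
      fix \<omega> assume "\<omega> \<in> space law"
      then have "(D T \<omega>)\<^sup>2 \<le> b\<^sup>2" using power_mono[OF D_bound[of \<omega> T] abs_ge_zero, of 2] by (simp only: power2_abs)
      then show "(M (Suc T) \<omega>)\<^sup>2 \<le> (M T \<omega>)\<^sup>2 + 2 * (M T \<omega> * D T \<omega>) + b\<^sup>2"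
        by (simp add: M_Suc power2_sum)
    qed (use int[of "\<lambda>m d. (m + d)\<^sup>2" T] int[of "\<lambda>m d. m\<^sup>2 + 2 * (m * d) + b\<^sup>2" T] in \<open>simp_all add: M_Suc\<close>)
    also have "\<dots> = (\<integral>\<omega>. (M T \<omega>)\<^sup>2 \<partial>law) + b\<^sup>2"
      using orth[of "\<lambda>m. m" T] int[of "\<lambda>m d. m\<^sup>2" T] int[of "\<lambda>m d. m * d" T] by (simp add: prob_space)
    finally show ?case using Suc.IH by (simp add: algebra_simps)
  qed
  have fourth: "(\<integral>\<omega>. (M T \<omega>) ^ 4 \<partial>law) \<le> 7 * b ^ 4 * (real T)\<^sup>2" for T
  proof (induction T)
    case 0
    then show ?case by (simp add: M_def)
  next
    case (Suc T)
    have "(\<integral>\<omega>. (M (Suc T) \<omega>) ^ 4 \<partial>law) \<le>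
        (\<integral>\<omega>. (M T \<omega>) ^ 4 + 4 * ((M T \<omega>) ^ 3 * D T \<omega>) + 8 * b\<^sup>2 * (M T \<omega>)\<^sup>2 + 3 * b ^ 4 \<partial>law)"
    proof (rule integral_mono)
      fix \<omega> assume "\<omega> \<in> space law"
      then show "(M (Suc T) \<omega>) ^ 4 \<le>
          (M T \<omega>) ^ 4 + 4 * ((M T \<omega>) ^ 3 * D T \<omega>) + 8 * b\<^sup>2 * (M T \<omega>)\<^sup>2 + 3 * b ^ 4"
        unfolding M_Suc by (intro fourth_power_increment D_bound)
    qed (use int[of "\<lambda>m d. (m + d) ^ 4" T]
          int[of "\<lambda>m d. m ^ 4 + 4 * (m ^ 3 * d) + 8 * b\<^sup>2 * m\<^sup>2 + 3 * b ^ 4" T] in \<open>simp_all add: M_Suc\<close>)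
    also have "\<dots> = (\<integral>\<omega>. (M T \<omega>) ^ 4 \<partial>law) + 8 * b\<^sup>2 * (\<integral>\<omega>. (M T \<omega>)\<^sup>2 \<partial>law) + 3 * b ^ 4"
      using orth[of "\<lambda>m. m ^ 3" T] int[of "\<lambda>m d. m\<^sup>2" T] int[of "\<lambda>m d. m ^ 3 * d" T]
        int[of "\<lambda>m d. m ^ 4" T] by (simp add: prob_space)
    also have "\<dots> \<le> 7 * b ^ 4 * (real T)\<^sup>2 + 8 * b\<^sup>2 * (b\<^sup>2 * real T) + 3 * b ^ 4"
      using Suc.IH second[of T] by (intro add_mono mult_left_mono) auto
    also have "\<dots> = b ^ 4 * (7 * (real T)\<^sup>2 + 8 * real T + 3)"
      by (simp add: power4_eq_xxxx power2_eq_square algebra_simps)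
    also have "\<dots> \<le> b ^ 4 * (7 * (real (Suc T))\<^sup>2)"
      by (intro mult_left_mono) (auto simp: power2_eq_square algebra_simps)
    finally show ?case by (simp add: mult_ac)
  qed
  let ?X = "\<lambda>T \<omega>. (M T \<omega> / real T) ^ 4"
  have X_meas [measurable]: "?X T \<in> borel_measurable law" for T
    using int[of "\<lambda>m d. (m / real T) ^ 4" T] by (rule borel_measurable_integrable)
  have term_bound: "(\<integral>\<^sup>+\<omega>. ennreal (?X T \<omega>) \<partial>law) \<le> ennreal (7 * b ^ 4 * inverse ((real T)\<^sup>2))" for T
  proof -
    have "(\<integral>\<^sup>+\<omega>. ennreal (?X T \<omega>) \<partial>law) = ennreal (\<integral>\<omega>. ?X T \<omega> \<partial>law)"
      using int[of "\<lambda>m d. (m / real T) ^ 4" T] by (intro nn_integral_eq_integral) auto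
    also have "(\<integral>\<omega>. ?X T \<omega> \<partial>law) = (\<integral>\<omega>. (M T \<omega>) ^ 4 \<partial>law) / real T ^ 4"
      by (simp add: power_divide)
    also have "\<dots> \<le> 7 * b ^ 4 * (real T)\<^sup>2 / real T ^ 4"
      by (intro divide_right_mono fourth) auto
    also have "\<dots> = 7 * b ^ 4 * inverse ((real T)\<^sup>2)"
      by (cases "T = 0") (auto simp: field_simps power4_eq_xxxx power2_eq_square)
    finally show ?thesis by (simp add: ennreal_leI)
  qed
  have "summable (\<lambda>T. 7 * b ^ 4 * inverse ((real T)\<^sup>2))"
    by (intro summable_mult inverse_power_summable) simp
  then have fin: "(\<Sum>T. ennreal (7 * b ^ 4 * inverse ((real T)\<^sup>2))) \<noteq> \<infinity>"
    by (subst suminf_ennreal_eq[OF _ summable_sums]) auto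
  have "(\<integral>\<^sup>+\<omega>. (\<Sum>T. ennreal (?X T \<omega>)) \<partial>law) = (\<Sum>T. \<integral>\<^sup>+\<omega>. ennreal (?X T \<omega>) \<partial>law)"
    by (intro nn_integral_suminf) measurable
  also have "\<dots> \<le> (\<Sum>T. ennreal (7 * b ^ 4 * inverse ((real T)\<^sup>2)))"
    by (intro suminf_le term_bound) auto
  finally have "(\<integral>\<^sup>+\<omega>. (\<Sum>T. ennreal (?X T \<omega>)) \<partial>law) \<noteq> \<infinity>"
    using fin by (auto simp: top_unique)
  then have "AE \<omega> in law. (\<Sum>T. ennreal (?X T \<omega>)) \<noteq> \<infinity>"
    by (intro nn_integral_PInf_AE) measurable
  then show ?thesis
  proof eventually_elim
    case (elim \<omega>)
    then have "summable (\<lambda>T. ?X T \<omega>)" by (intro summable_suminf_not_top) auto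
    then have "(\<lambda>T. ?X T \<omega>) \<longlonglongrightarrow> 0" by (rule summable_LIMSEQ_zero)
    then have "(\<lambda>T. sqrt (sqrt (?X T \<omega>))) \<longlonglongrightarrow> sqrt (sqrt 0)"
      by (intro tendsto_real_sqrt)
    moreover have "sqrt (sqrt (x ^ 4)) = \<bar>x\<bar>" for x :: real
    proof -
      have "x ^ 4 = (x\<^sup>2)\<^sup>2" by simp
      then have "sqrt (x ^ 4) = x\<^sup>2" by (simp only: real_sqrt_abs) simp
      then show ?thesis by simp
    qed
    ultimately have "(\<lambda>T. \<bar>M T \<omega> / real T\<bar>) \<longlonglongrightarrow> 0" by simp
    then show ?case unfolding M_def by (rule tendsto_rabs_zero_cancel)
  qed
qed

lemma stationary_actions:
  assumes det: "\<And>t \<omega> s. s \<in> S \<Longrightarrow> d t \<omega> s = return_pmf (f s)"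
  shows "AE \<omega> in law. \<forall>t. snd (\<omega> t) = f (fst (\<omega> t))"
proof -
  have "AE \<omega> in law. snd (\<omega> t) = f (fst (\<omega> t))" for t
  proof -
    let ?\<phi> = "indicator {z. snd z \<noteq> f (fst z)} :: 's \<times> 'a \<Rightarrow> real"
    have zero: "measure_pmf.expectation (step t \<omega>) ?\<phi> = 0" if \<omega>: "\<omega> \<in> space law" for \<omega>
    proof -
      have "snd z = f (fst z)" if z: "z \<in> set_pmf (step t \<omega>)" for z
      proof -
        have "fst z \<in> S" using set_step[of t \<omega>] in_space_law[OF \<omega>] z by auto
        with z show ?thesis unfolding step_pmf_def by (auto simp: det)
      qed
      then have "AE z in step t \<omega>. ?\<phi> z = 0" by (auto simp: AE_measure_pmf_iff)
      then show ?thesis by (rule integral_eq_zero_AE)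
    qed
    have "(\<integral>\<omega>. ?\<phi> (\<omega> t) \<partial>law) = (\<integral>\<omega>. measure_pmf.expectation (step t \<omega>) ?\<phi> \<partial>law)"
      using expectation_step[of t "\<lambda>_. 1" ?\<phi>] by (simp add: determined_by_def)
    also have "\<dots> = (\<integral>\<omega>. 0 \<partial>law)"
      by (intro Bochner_Integration.integral_cong refl zero)
    finally have "(\<integral>\<omega>. ?\<phi> (\<omega> t) \<partial>law) = 0" by simp
    then have "AE \<omega> in law. ?\<phi> (\<omega> t) = 0"
      using integral_nonneg_eq_0_iff_AE[of law "\<lambda>\<omega>. ?\<phi> (\<omega> t)"] coordinate_integrable[of ?\<phi> t]
      by simp
    then show ?thesis by eventually_elim (simp add: indicator_def split: if_splits)
  qed
  then show ?thesis by (simp add: AE_all_countable)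
qed

text \<open>
  Along a stationary policy the Poisson equation writes the total cost up to \<open>T\<close> as \<open>T \<rho>\<close> plus the
  bounded term \<open>h(s\<^sub>0) - h(s\<^sub>T)\<close> plus a martingale.
\<close>

lemma stationary_strong_law:
  assumes det: "\<And>t \<omega> s. s \<in> S \<Longrightarrow> d t \<omega> s = return_pmf (f s)"
    and poisson: "\<And>s. s \<in> S \<Longrightarrow>
      c (s, f s) = \<rho> + h s - measure_pmf.expectation (p s (f s)) h"
  shows "AE \<omega> in law. averages (\<lambda>t. c (\<omega> t)) \<longlonglongrightarrow> \<rho>"
proof -
  have actions: "AE \<omega> in law. \<forall>t. snd (\<omega> t) = f (fst (\<omega> t))"
    by (rule stationary_actions) (rule det)
  show ?thesis
    using actions martingale_strong_law[of h] AE_space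
  proof eventually_elim
    case (elim \<omega>)
    let ?D = "\<lambda>t. h (fst (\<omega> (Suc t))) - measure_pmf.expectation (p (fst (\<omega> t)) (snd (\<omega> t))) h"
    obtain b where b: "\<And>t. \<bar>h (fst (\<omega> t))\<bar> \<le> b"
      using coordinate_bounded[of "\<lambda>z. h (fst z)"] elim(3) by blast
    have one: "c (\<omega> t) = \<rho> + h (fst (\<omega> t)) - h (fst (\<omega> (Suc t))) + ?D t" for t
    proof -
      have "\<omega> t = (fst (\<omega> t), f (fst (\<omega> t)))" using elim(1) by (metis prod.collapse)
      moreover have "fst (\<omega> t) \<in> S" using in_space_law[OF elim(3), of t] by auto
      ultimately show ?thesis using poisson[of "fst (\<omega> t)"] by (metis (no_types, lifting) add_diff_cancel_left' add.commute diff_add_cancel diff_add_eq fst_conv snd_conv)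
    qed
    have sum: "(\<Sum>t<T. c (\<omega> t)) = real T * \<rho> + (h (fst (\<omega> 0)) - h (fst (\<omega> T))) + (\<Sum>t<T. ?D t)" for T
      by (induction T) (simp_all add: one algebra_simps)
    have "(\<lambda>T. (h (fst (\<omega> 0)) - h (fst (\<omega> T))) / real T) \<longlonglongrightarrow> 0"
    proof (rule Lim_null_comparison)
      show "\<forall>\<^sub>F T in sequentially. norm ((h (fst (\<omega> 0)) - h (fst (\<omega> T))) / real T) \<le> 2 * b / real T"
      proof (rule always_eventually, rule allI)
        fix T
        have "\<bar>h (fst (\<omega> 0)) - h (fst (\<omega> T))\<bar> \<le> 2 * b" using b[of 0] b[of T] by linarith
        then show "norm ((h (fst (\<omega> 0)) - h (fst (\<omega> T))) / real T) \<le> 2 * b / real T"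
          by (simp add: divide_right_mono)
      qed
      show "(\<lambda>T. 2 * b / real T) \<longlonglongrightarrow> 0" by (rule lim_const_over_n)
    qed
    then have "(\<lambda>T. \<rho> + (h (fst (\<omega> 0)) - h (fst (\<omega> T))) / real T + (\<Sum>t<T. ?D t) / real T)
        \<longlonglongrightarrow> \<rho> + 0 + 0"
      using elim(2) by (intro tendsto_intros)
    moreover have "\<forall>\<^sub>F T in sequentially. \<rho> + (h (fst (\<omega> 0)) - h (fst (\<omega> T))) / real T + (\<Sum>t<T. ?D t) / real T
        = averages (\<lambda>t. c (\<omega> t)) T"
      using eventually_gt_at_top[of 0]
      by eventually_elim (simp only: averages_def sum, simp add: field_simps)
    ultimately show ?case by (simp add: Lim_transform_eventually)
  qed
qed

end

section \<open>Marginals of the joint law\<close>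

lemma history_of_adapted: "determined_by t (\<lambda>\<tau>. history_of G i t \<tau> s)"
  by (rule determined_byI) (simp add: history_of_def)

lemma finite_players: "finite (players G)"
  by (simp add: players_def)

lemma controlled_process_player:
  assumes "valid_game G" "i \<in> players G" "u \<in> randomized_policies G i"
  shows "controlled_process (states G i) (actions G i) (init G i) (trans G i)
    (\<lambda>t \<tau> s. u t (history_of G i t \<tau> s))"
proof
  show "set_pmf (u t (history_of G i t \<tau> s)) \<subseteq> actions G i"
    if "\<forall>k<t. \<tau> k \<in> states G i \<times> actions G i" "s \<in> states G i" for t \<tau> s
    using assms(3) history_of_mem[OF that] unfolding randomized_policies_def by blast
  show "determined_by t (\<lambda>\<tau>. u t (history_of G i t \<tau> s))" for t s
    by (rule determined_byI) (metis determined_byD[OF history_of_adapted])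
qed (use assms in \<open>auto simp: valid_game_def\<close>)

lemma set_Pi_pmf_PiE:
  assumes "finite I" "\<And>i. i \<in> I \<Longrightarrow> set_pmf (q i) \<subseteq> B i"
  shows "set_pmf (Pi_pmf I undefined q) \<subseteq> PiE I B"
  using assms by (auto simp: set_Pi_pmf PiE_dflt_def PiE_iff extensional_def)

lemma component_mem:
  assumes "\<omega> k \<in> (\<Pi>\<^sub>E i\<in>players G. states G i) \<times> (\<Pi>\<^sub>E i\<in>players G. actions G i)" "i \<in> players G"
  shows "component i \<omega> k \<in> states G i \<times> actions G i"
  using assms by (auto simp: component_def mem_Times_iff)

lemma controlled_process_joint:
  assumes valid: "valid_game G" and u: "\<And>i. i \<in> players G \<Longrightarrow> u i \<in> randomized_policies G i"
  shows "controlled_process (\<Pi>\<^sub>E i\<in>players G. states G i) (\<Pi>\<^sub>E i\<in>players G. actions G i)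
    (restrict (init G) (players G)) (joint_trans G) (joint_decision G u)"
proof
  note fin = finite_players[of G]
  show "finite (\<Pi>\<^sub>E i\<in>players G. states G i)" "finite (\<Pi>\<^sub>E i\<in>players G. actions G i)"
    using valid fin by (auto intro!: finite_PiE simp: valid_game_def)
  show "restrict (init G) (players G) \<in> (\<Pi>\<^sub>E i\<in>players G. states G i)"
    using valid by (auto simp: valid_game_def)
  show "set_pmf (joint_trans G s a) \<subseteq> (\<Pi>\<^sub>E i\<in>players G. states G i)"
    if s: "s \<in> (\<Pi>\<^sub>E i\<in>players G. states G i)" and a: "a \<in> (\<Pi>\<^sub>E i\<in>players G. actions G i)" for s a
    unfolding joint_trans_def
  proof (rule set_Pi_pmf_PiE[OF fin])
    fix i assume "i \<in> players G"
    then show "set_pmf (trans G i (s i) (a i)) \<subseteq> states G i"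
      using valid PiE_mem[OF s] PiE_mem[OF a] unfolding valid_game_def by blast
  qed
  show "set_pmf (joint_decision G u t \<omega> s) \<subseteq> (\<Pi>\<^sub>E i\<in>players G. actions G i)"
    if \<omega>: "\<forall>k<t. \<omega> k \<in> (\<Pi>\<^sub>E i\<in>players G. states G i) \<times> (\<Pi>\<^sub>E i\<in>players G. actions G i)"
      and s: "s \<in> (\<Pi>\<^sub>E i\<in>players G. states G i)" for t \<omega> s
    unfolding joint_decision_def
  proof (rule set_Pi_pmf_PiE[OF fin])
    fix i assume i: "i \<in> players G"
    have "history_of G i t (component i \<omega>) (s i) \<in> histories G i t"
      using \<omega> i PiE_mem[OF s i] by (intro history_of_mem) (auto intro!: component_mem)
    then show "set_pmf (u i t (history_of G i t (component i \<omega>) (s i))) \<subseteq> actions G i"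
      using u[OF i] unfolding randomized_policies_def by blast
  qed
  show "determined_by t (\<lambda>\<omega>. joint_decision G u t \<omega> s)" for t s
  proof (rule determined_byI)
    fix \<omega> \<omega>' :: "nat \<Rightarrow> (nat \<Rightarrow> 'a) \<times> (nat \<Rightarrow> 'b)" assume eq: "\<And>k. k < t \<Longrightarrow> \<omega> k = \<omega>' k"
    have "history_of G i t (component i \<omega>) (s i) = history_of G i t (component i \<omega>') (s i)" for i
      by (rule determined_byD[OF history_of_adapted]) (simp add: component_def eq)
    then show "joint_decision G u t \<omega> s = joint_decision G u t \<omega>' s"
      by (simp add: joint_decision_def)
  qed
qed

text \<open>
  The independence of the players is used only here: the joint transition and the joint decision
  are product distributions, and player \<open>i\<close>'s factors depend on player \<open>i\<close>'s own trajectory alone.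
\<close>

lemma map_pmf_joint_step:
  assumes i: "i \<in> players G"
  shows "map_pmf (\<lambda>z. (fst z i, snd z i))
      (step_pmf (restrict (init G) (players G)) (joint_trans G) (joint_decision G u) t \<omega>) =
    step_pmf (init G i) (trans G i) (\<lambda>t \<tau> s. u i t (history_of G i t \<tau> s)) t (component i \<omega>)"
proof -
  note fin = finite_players[of G]
  define Q where "Q s = map_pmf (Pair s) (u i t (history_of G i t (component i \<omega>) s))" for s
  let ?base = "if t = 0 then return_pmf (restrict (init G) (players G))
    else joint_trans G (fst (\<omega> (t - 1))) (snd (\<omega> (t - 1)))"
  have "map_pmf (\<lambda>z. (fst z i, snd z i)) (map_pmf (Pair s) (joint_decision G u t \<omega> s)) = Q (s i)" for s
  proof -
    have "map_pmf (\<lambda>z. (fst z i, snd z i)) (map_pmf (Pair s) (joint_decision G u t \<omega> s)) =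
        map_pmf (Pair (s i)) (map_pmf (\<lambda>a. a i) (joint_decision G u t \<omega> s))"
      by (simp add: map_pmf_comp)
    then show ?thesis
      using i by (simp add: joint_decision_def Q_def Pi_pmf_component[OF fin])
  qed
  then have "map_pmf (\<lambda>z. (fst z i, snd z i))
      (step_pmf (restrict (init G) (players G)) (joint_trans G) (joint_decision G u) t \<omega>) =
      bind_pmf ?base (\<lambda>s. Q (s i))"
    by (simp add: step_pmf_def map_bind_pmf)
  also have "\<dots> = bind_pmf (map_pmf (\<lambda>s. s i) ?base) Q"
    by (simp add: bind_map_pmf)
  also have "map_pmf (\<lambda>s. s i) ?base = (if t = 0 then return_pmf (init G i)
      else trans G i (fst (component i \<omega> (t - 1))) (snd (component i \<omega> (t - 1))))"
    using i by (simp add: joint_trans_def component_def Pi_pmf_component[OF fin])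
  also have "bind_pmf \<dots> Q =
      step_pmf (init G i) (trans G i) (\<lambda>t \<tau> s. u i t (history_of G i t \<tau> s)) t (component i \<omega>)"
    by (simp add: step_pmf_def Q_def[abs_def])
  finally show ?thesis .
qed

text \<open>
  Player \<open>i\<close>'s trajectory has prefix probabilities that satisfy the recursion of the process
  controlled by player \<open>i\<close> alone. On the event that the past of player \<open>i\<close> is the given prefix, the
  conditional probability of the next pair does not depend on the other players, although the joint
  step distribution does.
\<close>

lemma
  assumes valid: "valid_game G" and u: "\<And>i. i \<in> players G \<Longrightarrow> u i \<in> randomized_policies G i"
    and i: "i \<in> players G"
  shows component_measurable: "component i \<in> measurable (joint_law G u) (player_law G i (u i))"
    and distr_component: "distr (joint_law G u) (player_law G i (u i)) (component i) = player_law G i (u i)"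
proof -
  define s0 where "s0 = restrict (init G) (players G)"
  interpret J: controlled_process "\<Pi>\<^sub>E i\<in>players G. states G i" "\<Pi>\<^sub>E i\<in>players G. actions G i"
    s0 "joint_trans G" "joint_decision G u"
    unfolding s0_def by (rule controlled_process_joint[OF valid u])
  interpret P: controlled_process "states G i" "actions G i" "init G i" "trans G i"
    "\<lambda>t \<tau> s. u i t (history_of G i t \<tau> s)"
    by (rule controlled_process_player[OF valid i u[OF i]])
  have J: "joint_law G u = J.law" by (simp add: joint_law_def s0_def)
  have P: "player_law G i (u i) = P.law" by (simp add: player_law_def)
  have meas: "component i \<in> measurable J.law P.law"
  proof -
    have "(\<lambda>\<omega> t. (fst (\<omega> t) i, snd (\<omega> t) i)) \<in>
        measurable J.law (PiM UNIV (\<lambda>_. count_space (states G i \<times> actions G i)))"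
    proof (rule measurable_PiM_single')
      fix t :: nat
      have "(\<lambda>z. (fst z i, snd z i)) \<in> measurable
          (count_space ((\<Pi>\<^sub>E i\<in>players G. states G i) \<times> (\<Pi>\<^sub>E i\<in>players G. actions G i)))
          (count_space (states G i \<times> actions G i))"
        using i by auto
      moreover have "(\<lambda>\<omega>. \<omega> t) \<in> measurable J.law
          (count_space ((\<Pi>\<^sub>E i\<in>players G. states G i) \<times> (\<Pi>\<^sub>E i\<in>players G. actions G i)))"
        by measurable
      ultimately show "(\<lambda>\<omega>. (fst (\<omega> t) i, snd (\<omega> t) i)) \<in>
          measurable J.law (count_space (states G i \<times> actions G i))"
        by (rule measurable_compose[rotated])
    next
      show "(\<lambda>\<omega> t. (fst (\<omega> t) i, snd (\<omega> t) i)) \<in>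
          space J.law \<rightarrow> (UNIV \<rightarrow>\<^sub>E space (count_space (states G i \<times> actions G i)))"
      proof (rule Pi_I)
        fix \<omega> assume "\<omega> \<in> space J.law"
        then have "component i \<omega> t \<in> states G i \<times> actions G i" for t
          by (intro component_mem J.in_space_law i)
        then show "(\<lambda>t. (fst (\<omega> t) i, snd (\<omega> t) i)) \<in>
            (UNIV \<rightarrow>\<^sub>E space (count_space (states G i \<times> actions G i)))"
          unfolding component_def by (simp add: PiE_iff)
      qed
    qed
    then show ?thesis
      by (simp add: component_def[abs_def] measurable_cong_sets[OF refl P.sets_law])
  qed
  show "component i \<in> measurable (joint_law G u) (player_law G i (u i))"
    unfolding J P by (rule meas)
  interpret Jp: prob_space J.law by (rule J.prob_space_law)
  have prefix: "(\<integral>\<omega>. of_bool (\<forall>k<n. component i \<omega> k = x k) \<partial>J.law) = P.weight n x" for n x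
  proof (induction n)
    case 0
    then show ?case by (simp add: P.weight_def Jp.prob_space)
  next
    case (Suc n)
    define B where "B \<omega> = (of_bool (\<forall>k<n. component i \<omega> k = x k) :: real)" for \<omega>
    define \<phi> where "\<phi> = (indicator ((\<lambda>z. (fst z i, snd z i)) -` {x n}) :: _ \<Rightarrow> real)"
    have B_det: "determined_by n B"
      unfolding B_def component_def by (rule determined_byI) auto
    have \<phi>: "measure_pmf.expectation (J.step n \<omega>) \<phi> = pmf (P.step n (component i \<omega>)) (x n)" for \<omega>
      unfolding map_pmf_joint_step[OF i, folded s0_def, symmetric] \<phi>_def by (simp add: pmf_map)
    have "(\<integral>\<omega>. of_bool (\<forall>k<Suc n. component i \<omega> k = x k) \<partial>J.law) = (\<integral>\<omega>. B \<omega> * \<phi> (\<omega> n) \<partial>J.law)"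
      by (intro Bochner_Integration.integral_cong refl)
        (auto simp: B_def \<phi>_def less_Suc_eq component_def)
    also have "\<dots> = (\<integral>\<omega>. B \<omega> * pmf (P.step n (component i \<omega>)) (x n) \<partial>J.law)"
      unfolding J.expectation_step[OF B_det] \<phi> ..
    also have "\<dots> = (\<integral>\<omega>. B \<omega> * pmf (P.step n x) (x n) \<partial>J.law)"
    proof (intro Bochner_Integration.integral_cong refl)
      fix \<omega>
      show "B \<omega> * pmf (P.step n (component i \<omega>)) (x n) = B \<omega> * pmf (P.step n x) (x n)"
      proof (cases "\<forall>k<n. component i \<omega> k = x k")
        case True
        then have "P.step n (component i \<omega>) = P.step n x"
          by (intro determined_byD[OF P.step_adapted]) auto
        then show ?thesis by simp
      qed (simp add: B_def)
    qed
    also have "\<dots> = P.weight n x * pmf (P.step n x) (x n)"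
      using Suc.IH by (simp add: B_def)
    finally show ?case by (simp add: P.weight_def)
  qed
  have "distr J.law P.law (component i) = P.law"
  proof (rule P.law_eqI)
    show "prob_space (distr J.law P.law (component i))" by (rule Jp.prob_space_distr[OF meas])
    show "sets (distr J.law P.law (component i)) = sets P.law" by simp
    fix n and x :: "nat \<Rightarrow> 'a \<times> 'b"
    have set: "component i -` {\<tau> \<in> space P.law. \<forall>k<n. \<tau> k = x k} \<inter> space J.law =
        {\<omega> \<in> space J.law. \<forall>k<n. component i \<omega> k = x k}"
      using measurable_space[OF meas] by auto
    have "emeasure (distr J.law P.law (component i)) {\<tau> \<in> space P.law. \<forall>k<n. \<tau> k = x k} =
        emeasure J.law {\<omega> \<in> space J.law. \<forall>k<n. component i \<omega> k = x k}"
      using set by (simp add: emeasure_distr[OF meas P.prefix_set_measurable])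
    also have "\<dots> = ennreal (Jp.prob {\<omega> \<in> space J.law. \<forall>k<n. component i \<omega> k = x k})"
      by (rule Jp.emeasure_eq_measure)
    also have "Jp.prob {\<omega> \<in> space J.law. \<forall>k<n. component i \<omega> k = x k} =
        (\<integral>\<omega>. indicator {\<omega> \<in> space J.law. \<forall>k<n. component i \<omega> k = x k} \<omega> \<partial>J.law)"
    proof -
      have eq: "{\<omega> \<in> space J.law. \<forall>k<n. component i \<omega> k = x k} \<inter> space J.law =
          {\<omega> \<in> space J.law. \<forall>k<n. component i \<omega> k = x k}"
        by (rule Int_absorb2[OF Collect_restrict])
      show ?thesis unfolding Bochner_Integration.integral_indicator eq ..
    qed
    also have "\<dots> = (\<integral>\<omega>. of_bool (\<forall>k<n. component i \<omega> k = x k) \<partial>J.law)"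
      by (intro Bochner_Integration.integral_cong refl) (simp add: indicator_def)
    finally show "emeasure (distr J.law P.law (component i)) {\<tau> \<in> space P.law. \<forall>k<n. \<tau> k = x k} =
        ennreal (P.weight n x)"
      unfolding prefix .
  qed
  then show "distr (joint_law G u) (player_law G i (u i)) (component i) = player_law G i (u i)"
    unfolding J P .
qed

lemma joint_expectation_component:
  fixes F :: "(nat \<Rightarrow> 's \<times> 'a) \<Rightarrow> real" and G :: "('s, 'a) game"
  assumes "valid_game G" and "\<And>i. i \<in> players G \<Longrightarrow> u i \<in> randomized_policies G i"
    and "i \<in> players G" and F: "integrable (player_law G i (u i)) F"
  shows "integrable (joint_law G u) (\<lambda>\<omega>. F (component i \<omega>))"
    and "(\<integral>\<omega>. F (component i \<omega>) \<partial>joint_law G u) = (\<integral>\<tau>. F \<tau> \<partial>player_law G i (u i))"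
proof -
  note m = component_measurable[OF assms(1-3)] and d = distr_component[OF assms(1-3)]
  have F_meas: "F \<in> borel_measurable (player_law G i (u i))" using F by simp
  show "integrable (joint_law G u) (\<lambda>\<omega>. F (component i \<omega>))"
    using integrable_distr_eq[OF m F_meas] F by (simp add: d)
  show "(\<integral>\<omega>. F (component i \<omega>) \<partial>joint_law G u) = (\<integral>\<tau>. F \<tau> \<partial>player_law G i (u i))"
    using integral_distr[OF m F_meas] by (simp add: d)
qed

section \<open>Team variance and pseudo variances\<close>

definition mean_reward :: "('s, 'a) game \<Rightarrow> nat \<Rightarrow> ('s, 'a) policy \<Rightarrow> real" where
  "mean_reward G i v = (\<integral>\<tau>. lim (averages (rewards G i \<tau>)) \<partial>player_law G i v)"

definition mean_square_reward :: "('s, 'a) game \<Rightarrow> nat \<Rightarrow> ('s, 'a) policy \<Rightarrow> real" where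
  "mean_square_reward G i v = (\<integral>\<tau>. lim (averages (\<lambda>t. (rewards G i \<tau> t)\<^sup>2)) \<partial>player_law G i v)"

lemma averages_square_deviation:
  assumes "averages x \<longlonglongrightarrow> m" "averages (\<lambda>t. (x t)\<^sup>2) \<longlonglongrightarrow> q"
  shows "averages (\<lambda>t. (x t - y)\<^sup>2) \<longlonglongrightarrow> q - 2 * y * m + y\<^sup>2"
proof -
  have "(\<lambda>T. averages (\<lambda>t. (x t)\<^sup>2) T - 2 * y * averages x T + y\<^sup>2) \<longlonglongrightarrow> q - 2 * y * m + y\<^sup>2"
    by (intro tendsto_intros assms)
  moreover have "\<forall>\<^sub>F T in sequentially.
      averages (\<lambda>t. (x t)\<^sup>2) T - 2 * y * averages x T + y\<^sup>2 = averages (\<lambda>t. (x t - y)\<^sup>2) T"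
    using eventually_gt_at_top[of 0]
  proof eventually_elim
    case (elim T)
    have "(\<Sum>t<T. (x t - y)\<^sup>2) = (\<Sum>t<T. (x t)\<^sup>2) - 2 * y * (\<Sum>t<T. x t) + real T * y\<^sup>2"
      by (simp add: power2_diff sum.distrib sum_subtractf sum_distrib_left mult_ac)
    then show ?case using elim by (simp add: averages_def field_simps)
  qed
  ultimately show ?thesis by (rule Lim_transform_eventually)
qed

text \<open>
  Expanding \<open>(r - y)\<^sup>2\<close> reduces the limit for every \<open>y\<close> to the two limits whose existence admissibility
  demands.
\<close>

lemma admissible_limits:
  assumes valid: "valid_game G" and i: "i \<in> players G" and v: "v \<in> admissible_policies G i"
  shows admissible_convergent: "AE \<tau> in player_law G i v. convergent (averages (\<lambda>t. (rewards G i \<tau> t - y)\<^sup>2))"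
    and admissible_integrable_mean: "integrable (player_law G i v) (\<lambda>\<tau>. lim (averages (rewards G i \<tau>)))"
    and admissible_integrable_square:
      "integrable (player_law G i v) (\<lambda>\<tau>. lim (averages (\<lambda>t. (rewards G i \<tau> t - y)\<^sup>2)))"
    and pseudo_variance_quadratic:
      "pseudo_variance G i y v = mean_square_reward G i v - 2 * y * mean_reward G i v + y\<^sup>2"
proof -
  have rand: "v \<in> randomized_policies G i" using v by (simp add: admissible_policies_def)
  interpret P: controlled_process "states G i" "actions G i" "init G i" "trans G i"
    "\<lambda>t \<tau> s. v t (history_of G i t \<tau> s)"
    by (rule controlled_process_player[OF valid i rand])
  interpret prob_space P.law by (rule P.prob_space_law)
  have P: "player_law G i v = P.law" by (simp add: player_law_def)
  have c1: "AE \<tau> in P.law. convergent (averages (rewards G i \<tau>))"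
    and c2: "AE \<tau> in P.law. convergent (averages (\<lambda>t. (rewards G i \<tau> t)\<^sup>2))"
    unfolding P[symmetric] using v by (simp_all add: admissible_policies_def)
  have lims: "AE \<tau> in P.law. averages (\<lambda>t. (rewards G i \<tau> t - y)\<^sup>2) \<longlonglongrightarrow>
      lim (averages (\<lambda>t. (rewards G i \<tau> t)\<^sup>2)) - 2 * y * lim (averages (rewards G i \<tau>)) + y\<^sup>2" for y
    using c1 c2 by eventually_elim (intro averages_square_deviation convergent_averages_lim)
  have conv: "AE \<tau> in P.law. convergent (averages (\<lambda>t. (rewards G i \<tau> t - y)\<^sup>2))" for y
    using lims[of y] by eventually_elim (rule convergentI)
  then show "AE \<tau> in player_law G i v. convergent (averages (\<lambda>t. (rewards G i \<tau> t - y)\<^sup>2))"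
    unfolding P .
  have int1: "integrable P.law (\<lambda>\<tau>. lim (averages (rewards G i \<tau>)))"
    using P.lim_averages_integral(1)[of "\<lambda>z. reward G i (fst z) (snd z)"] c1
    by (simp add: rewards_def[abs_def])
  have int2: "integrable P.law (\<lambda>\<tau>. lim (averages (\<lambda>t. (rewards G i \<tau> t - y)\<^sup>2)))" for y
    using P.lim_averages_integral(1)[of "\<lambda>z. (reward G i (fst z) (snd z) - y)\<^sup>2"] conv[of y]
    by (simp add: rewards_def)
  show "integrable (player_law G i v) (\<lambda>\<tau>. lim (averages (rewards G i \<tau>)))"
    "integrable (player_law G i v) (\<lambda>\<tau>. lim (averages (\<lambda>t. (rewards G i \<tau> t - y)\<^sup>2)))"
    unfolding P by (fact int1 int2)+
  have int0: "integrable P.law (\<lambda>\<tau>. lim (averages (\<lambda>t. (rewards G i \<tau> t)\<^sup>2)))"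
    using int2[of 0] by simp
  have "pseudo_variance G i y v = (\<integral>\<tau>. lim (averages (\<lambda>t. (rewards G i \<tau> t)\<^sup>2)) -
      2 * y * lim (averages (rewards G i \<tau>)) + y\<^sup>2 \<partial>P.law)"
    unfolding pseudo_variance_def P
  proof (rule integral_cong_AE)
    show "AE \<tau> in P.law. lim (averages (\<lambda>t. (rewards G i \<tau> t - y)\<^sup>2)) =
        lim (averages (\<lambda>t. (rewards G i \<tau> t)\<^sup>2)) - 2 * y * lim (averages (rewards G i \<tau>)) + y\<^sup>2"
      using lims[of y] by eventually_elim (rule limI)
  qed (use int0 int1 int2[of y] in auto)
  also have "\<dots> = mean_square_reward G i v - 2 * y * mean_reward G i v + y\<^sup>2"
    unfolding mean_square_reward_def mean_reward_def P using int0 int1 by (simp add: prob_space)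
  finally show "pseudo_variance G i y v = mean_square_reward G i v - 2 * y * mean_reward G i v + y\<^sup>2" .
qed

lemma joint_policies_admissible:
  "u \<in> joint_policies G \<Longrightarrow> i \<in> players G \<Longrightarrow> u i \<in> admissible_policies G i"
  unfolding joint_policies_def by (rule PiE_mem)

lemma
  assumes valid: "valid_game G" and u: "u \<in> joint_policies G"
  shows team_mean_eq: "real (nplayers G) * team_mean G u = (\<Sum>i\<in>players G. mean_reward G i (u i))"
    and team_variance_eq: "team_variance G u = (\<Sum>i\<in>players G. pseudo_variance G i (team_mean G u) (u i))"
proof -
  have adm: "u i \<in> admissible_policies G i" if "i \<in> players G" for i
    using joint_policies_admissible[OF u that] .
  then have rand: "u i \<in> randomized_policies G i" if "i \<in> players G" for i
    using that by (auto simp: admissible_policies_def)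
  have n: "nplayers G \<ge> 1" using valid by (simp add: valid_game_def)
  note tr1 = joint_expectation_component[OF valid rand _ admissible_integrable_mean[OF valid _ adm]]
  have "(\<integral>\<omega>. (\<Sum>i\<in>players G. lim (averages (rewards G i (component i \<omega>)))) \<partial>joint_law G u) =
      (\<Sum>i\<in>players G. mean_reward G i (u i))"
    unfolding mean_reward_def
    by (subst Bochner_Integration.integral_sum) (auto intro!: sum.cong tr1)
  then show "real (nplayers G) * team_mean G u = (\<Sum>i\<in>players G. mean_reward G i (u i))"
    unfolding team_mean_def using n by simp
  note tr2 = joint_expectation_component[OF valid rand _ admissible_integrable_square[OF valid _ adm]]
  show "team_variance G u = (\<Sum>i\<in>players G. pseudo_variance G i (team_mean G u) (u i))"
    unfolding team_variance_def pseudo_variance_def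
    by (subst Bochner_Integration.integral_sum) (auto intro!: sum.cong tr2)
qed

text \<open>
  Each pseudo variance is a quadratic polynomial in \<open>y\<close> with leading coefficient one, whose linear
  coefficients add up to \<open>- 2 n\<close> times the team mean. Completing the square gives the identity.
\<close>

lemma sum_pseudo_variance:
  assumes valid: "valid_game G" and u: "u \<in> joint_policies G"
  shows "(\<Sum>i\<in>players G. pseudo_variance G i y (u i)) =
    team_variance G u + real (nplayers G) * (y - team_mean G u)\<^sup>2"
proof -
  let ?q = "\<Sum>i\<in>players G. mean_square_reward G i (u i)"
    and ?m = "\<Sum>i\<in>players G. mean_reward G i (u i)"
  have card: "card (players G) = nplayers G" by (simp add: players_def)
  have quadratic: "(\<Sum>i\<in>players G. pseudo_variance G i y (u i)) = ?q - 2 * y * ?m + real (nplayers G) * y\<^sup>2" for y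
    using pseudo_variance_quadratic[OF valid _ joint_policies_admissible[OF u]]
    by (simp add: sum.distrib sum_subtractf sum_distrib_left card)
  show ?thesis
    unfolding team_variance_eq[OF assms] quadratic team_mean_eq[OF assms, symmetric]
    by (simp add: power2_eq_square algebra_simps)
qed

section \<open>Optimality of stationary deterministic policies\<close>

definition stationary :: "('s \<Rightarrow> 'a) \<Rightarrow> ('s, 'a) policy" where
  "stationary f = (\<lambda>t h. return_pmf (f (snd h)))"

lemma irreducible_mdp_player:
  assumes "valid_game G" "ergodic_game G" "i \<in> players G"
  shows "irreducible_mdp (states G i) (actions G i) (trans G i)"
  using assms by unfold_locales (auto simp: valid_game_def ergodic_game_def ergodic_chain_def)

context
  fixes G :: "('s, 'a) game" and i :: nat
  assumes valid: "valid_game G" and ergodic: "ergodic_game G" and i: "i \<in> players G"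
begin

interpretation irreducible_mdp "states G i" "actions G i" "trans G i"
  by (rule irreducible_mdp_player[OF valid ergodic i])

lemma stationary_randomized:
  "f \<in> states G i \<rightarrow> actions G i \<Longrightarrow> stationary f \<in> randomized_policies G i"
  by (auto simp: stationary_def randomized_policies_def histories_def)

lemma stationary_converges:
  assumes f: "f \<in> states G i \<rightarrow> actions G i" and ev: "evaluates (\<lambda>s a. c (s, a)) f g h"
  shows "AE \<tau> in player_law G i (stationary f). averages (\<lambda>t. c (\<tau> t)) \<longlonglongrightarrow> g"
proof -
  interpret P: controlled_process "states G i" "actions G i" "init G i" "trans G i"
    "\<lambda>t \<tau> s. stationary f t (history_of G i t \<tau> s)"
    by (rule controlled_process_player[OF valid i stationary_randomized[OF f]])
  show ?thesis
    unfolding player_law_def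
    by (rule P.stationary_strong_law[where f=f and h=h])
      (use ev in \<open>auto simp: stationary_def history_of_def evaluates_def\<close>)
qed

lemma stationary_admissible:
  assumes f: "f \<in> states G i \<rightarrow> actions G i"
  shows "stationary f \<in> admissible_policies G i"
proof -
  have conv: "AE \<tau> in player_law G i (stationary f). convergent (averages (\<lambda>t. c (\<tau> t)))"
    for c :: "'s \<times> 'a \<Rightarrow> real"
  proof -
    obtain g h where "evaluates (\<lambda>s a. c (s, a)) f g h" using evaluates_exists[OF f] by blast
    from stationary_converges[OF f this] show ?thesis
      by eventually_elim (rule convergentI)
  qed
  show ?thesis
    using stationary_randomized[OF f] conv[of "\<lambda>z. reward G i (fst z) (snd z)"]
      conv[of "\<lambda>z. (reward G i (fst z) (snd z))\<^sup>2"]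
    by (simp add: admissible_policies_def rewards_def[abs_def])
qed

text \<open>
  The policy of minimal gain for the cost \<open>(r - y)\<^sup>2\<close> has pseudo variance equal to its gain, by the
  strong law, and the gain is a lower bound for every admissible policy.
\<close>

lemma stationary_optimal:
  "\<exists>f\<in>states G i \<rightarrow>\<^sub>E actions G i. \<forall>v\<in>admissible_policies G i.
    pseudo_variance G i y (stationary f) \<le> pseudo_variance G i y v"
proof -
  define c where "c z = (reward G i (fst z) (snd z) - y)\<^sup>2" for z
  have pv: "pseudo_variance G i y v = (\<integral>\<tau>. lim (averages (\<lambda>t. c (\<tau> t))) \<partial>player_law G i v)" for v
    by (simp add: pseudo_variance_def c_def rewards_def)
  obtain f g h where f: "f \<in> states G i \<rightarrow>\<^sub>E actions G i"
    and ev: "evaluates (\<lambda>s a. c (s, a)) f g h"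
    and opt: "\<And>s a. s \<in> states G i \<Longrightarrow> a \<in> actions G i \<Longrightarrow>
      g + h s \<le> c (s, a) + measure_pmf.expectation (trans G i s a) h"
    using optimality_inequality[of "\<lambda>s a. c (s, a)"] by blast
  have f': "f \<in> states G i \<rightarrow> actions G i" using f by auto
  have lower: "g \<le> pseudo_variance G i y v" if v: "v \<in> admissible_policies G i" for v
  proof -
    have rand: "v \<in> randomized_policies G i" using v by (simp add: admissible_policies_def)
    interpret P: controlled_process "states G i" "actions G i" "init G i" "trans G i"
      "\<lambda>t \<tau> s. v t (history_of G i t \<tau> s)"
      by (rule controlled_process_player[OF valid i rand])
    have "AE \<tau> in P.law. convergent (averages (\<lambda>t. c (\<tau> t)))"
      using admissible_convergent[OF valid i v, of y] unfolding c_def rewards_def player_law_def .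
    then show ?thesis
      unfolding pv player_law_def by (intro P.gain_lower_bound[where h=h] opt)
  qed
  have "pseudo_variance G i y (stationary f) = g"
  proof -
    interpret P: controlled_process "states G i" "actions G i" "init G i" "trans G i"
      "\<lambda>t \<tau> s. stationary f t (history_of G i t \<tau> s)"
      by (rule controlled_process_player[OF valid i stationary_randomized[OF f']])
    interpret prob_space P.law by (rule P.prob_space_law)
    have P: "player_law G i (stationary f) = P.law" by (simp add: player_law_def)
    have "(\<integral>\<tau>. lim (averages (\<lambda>t. c (\<tau> t))) \<partial>P.law) = (\<integral>\<tau>. g \<partial>P.law)"
    proof (rule integral_cong_AE)
      show "AE \<tau> in P.law. lim (averages (\<lambda>t. c (\<tau> t))) = g"
        using stationary_converges[OF f' ev] unfolding P by eventually_elim (rule limI)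
    qed (auto intro: P.lim_averages_measurable)
    then show ?thesis by (simp add: pv P prob_space)
  qed
  then show ?thesis using f lower by (intro bexI[of _ f]) auto
qed

end

section \<open>Equivalence of the two problems\<close>

lemma is_arg_min_iff_le:
  fixes f :: "'a \<Rightarrow> real"
  shows "is_arg_min f P x \<longleftrightarrow> P x \<and> (\<forall>y. P y \<longrightarrow> f x \<le> f y)"
  by (auto simp: is_arg_min_def not_less)

theorem theorem1:
  fixes G :: "('s, 'a) game"
  assumes "valid_game G" and "ergodic_game G"
  shows
    "(\<exists>u. is_arg_min (team_variance G) (\<lambda>u. u \<in> joint_policies G) u) \<and>
     (\<forall>y. \<forall>i\<in>players G.
        \<exists>v. is_arg_min (pseudo_variance G i y) (\<lambda>v. v \<in> admissible_policies G i) v) \<and>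
     (\<exists>y. is_arg_min (bilevel_objective G) (\<lambda>_. True) y) \<and>
     (INF u\<in>joint_policies G. team_variance G u) = (INF y. bilevel_objective G y) \<and>
     (\<forall>u\<in>joint_policies G.
        is_arg_min (team_variance G) (\<lambda>u. u \<in> joint_policies G) u \<longleftrightarrow>
        (\<exists>y. is_arg_min (bilevel_objective G) (\<lambda>_. True) y \<and>
          (\<forall>i\<in>players G.
             is_arg_min (pseudo_variance G i y) (\<lambda>v. v \<in> admissible_policies G i) (u i))))"
proof -
  let ?F = "\<lambda>i. states G i \<rightarrow>\<^sub>E actions G i"
  let ?U = "\<lambda>\<phi>. \<lambda>i\<in>players G. stationary (\<phi> i)"
  \<comment> \<open>The finite set of stationary deterministic profiles, the same for all \<open>y\<close>.\<close>
  define D where "D = ?U ` (\<Pi>\<^sub>E i\<in>players G. ?F i)"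
  note fin = finite_players[of G]
  have adm: "stationary f \<in> admissible_policies G i" if "i \<in> players G" "f \<in> ?F i" for i f
    using stationary_admissible[OF assms that(1)] that(2) by auto
  have D_sub: "D \<subseteq> joint_policies G"
  proof -
    have "?U \<phi> \<in> joint_policies G" if "\<phi> \<in> (\<Pi>\<^sub>E i\<in>players G. ?F i)" for \<phi>
      unfolding joint_policies_def restrict_PiE_iff using adm PiE_mem[OF that] by blast
    then show ?thesis unfolding D_def by blast
  qed
  have D_fin: "finite D"
    unfolding D_def using assms(1) fin by (intro finite_imageI finite_PiE) (auto simp: valid_game_def)
  have "?F i \<noteq> {}" if "i \<in> players G" for i
    using assms(1) that by (auto simp: valid_game_def PiE_eq_empty_iff)
  then have D_ne: "D \<noteq> {}" unfolding D_def by (simp add: PiE_eq_empty_iff)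

  have inner: "\<exists>u\<in>D. \<forall>i\<in>players G. \<forall>v\<in>admissible_policies G i.
      pseudo_variance G i y (u i) \<le> pseudo_variance G i y v" for y
  proof -
    have "\<forall>i\<in>players G. \<exists>f\<in>?F i. \<forall>v\<in>admissible_policies G i.
        pseudo_variance G i y (stationary f) \<le> pseudo_variance G i y v"
      using stationary_optimal[OF assms] by blast
    then obtain \<phi> where \<phi>: "\<And>i. i \<in> players G \<Longrightarrow> \<phi> i \<in> ?F i \<and> (\<forall>v\<in>admissible_policies G i.
        pseudo_variance G i y (stationary (\<phi> i)) \<le> pseudo_variance G i y v)"
      by metis
    have "?U (restrict \<phi> (players G)) \<in> D"
      unfolding D_def by (rule imageI) (use \<phi> in \<open>unfold restrict_PiE_iff, blast\<close>)
    then show ?thesis using \<phi> by (intro bexI[of _ "?U (restrict \<phi> (players G))"]) auto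
  qed
  have bilevel: "bilevel_objective G y = (\<Sum>i\<in>players G. pseudo_variance G i y (u i))"
    if u: "u \<in> joint_policies G" and best: "\<forall>i\<in>players G. \<forall>v\<in>admissible_policies G i.
      pseudo_variance G i y (u i) \<le> pseudo_variance G i y v" for u y
    unfolding bilevel_objective_def
  proof (intro sum.cong refl cInf_eq_minimum)
    fix i assume i: "i \<in> players G"
    show "pseudo_variance G i y (u i) \<in> pseudo_variance G i y ` admissible_policies G i"
      by (rule imageI) (rule joint_policies_admissible[OF u i])
    show "pseudo_variance G i y (u i) \<le> x"
      if "x \<in> pseudo_variance G i y ` admissible_policies G i" for x
      using best i that by blast
  qed

  \<comment> \<open>The best stationary deterministic profile turns out to be optimal among all profiles.\<close>
  define w where "w = arg_min_on (team_variance G) D"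
  have w: "w \<in> D" and w_min: "\<And>u. u \<in> D \<Longrightarrow> team_variance G w \<le> team_variance G u"
    unfolding w_def using arg_min_if_finite(1)[OF D_fin D_ne] arg_min_least[OF D_fin D_ne] by auto
  have w_joint: "w \<in> joint_policies G" using w D_sub by blast

  have tv_le: "team_variance G u \<le> (\<Sum>i\<in>players G. pseudo_variance G i y (u i))"
    if "u \<in> joint_policies G" for u y
    using sum_pseudo_variance[OF assms(1) that, of y] by simp
  have bl_le: "bilevel_objective G y \<le> (\<Sum>i\<in>players G. pseudo_variance G i y (u i))"
    if u: "u \<in> joint_policies G" for u y
  proof -
    obtain d where d: "d \<in> D" "\<forall>i\<in>players G. \<forall>v\<in>admissible_policies G i.
      pseudo_variance G i y (d i) \<le> pseudo_variance G i y v" using inner by blast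
    have "bilevel_objective G y = (\<Sum>i\<in>players G. pseudo_variance G i y (d i))"
      using bilevel d D_sub by blast
    also have "\<dots> \<le> (\<Sum>i\<in>players G. pseudo_variance G i y (u i))"
      by (rule sum_mono) (use d joint_policies_admissible[OF u] in blast)
    finally show ?thesis .
  qed
  have bl_ge: "team_variance G w \<le> bilevel_objective G y" for y
  proof -
    obtain d where d: "d \<in> D" "\<forall>i\<in>players G. \<forall>v\<in>admissible_policies G i.
      pseudo_variance G i y (d i) \<le> pseudo_variance G i y v" using inner by blast
    have "team_variance G w \<le> team_variance G d" using w_min d by blast
    also have "\<dots> \<le> (\<Sum>i\<in>players G. pseudo_variance G i y (d i))"
      using tv_le d D_sub by blast
    also have "\<dots> = bilevel_objective G y" using bilevel d D_sub by fastforce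
    finally show ?thesis .
  qed
  have bl_mean: "bilevel_objective G (team_mean G u) \<le> team_variance G u"
    if "u \<in> joint_policies G" for u
    using bl_le[OF that, of "team_mean G u"] team_variance_eq[OF assms(1) that] by simp
  have w_opt: "team_variance G w \<le> team_variance G u" if "u \<in> joint_policies G" for u
    using bl_ge bl_mean[OF that] by (rule order_trans)
  have attained: "bilevel_objective G (team_mean G w) = team_variance G w"
    using bl_ge bl_mean[OF w_joint] by (rule antisym[rotated])
  have team_opt: "is_arg_min (team_variance G) (\<lambda>u. u \<in> joint_policies G) u \<longleftrightarrow>
      team_variance G u = team_variance G w" if "u \<in> joint_policies G" for u
    using that w_opt w_joint by (auto simp: is_arg_min_iff_le intro: antisym)
  have bl_opt: "is_arg_min (bilevel_objective G) (\<lambda>_. True) y \<longleftrightarrow>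
      bilevel_objective G y = team_variance G w" for y
    using bl_ge attained by (auto simp: is_arg_min_iff_le intro: antisym) (metis antisym)
  have infs: "(INF u\<in>joint_policies G. team_variance G u) = team_variance G w"
    "(INF y. bilevel_objective G y) = team_variance G w"
    using w_joint w_opt bl_ge attained by (auto intro!: cInf_eq_minimum simp: image_iff) (metis)
  have equiv: "is_arg_min (team_variance G) (\<lambda>u. u \<in> joint_policies G) u \<longleftrightarrow>
      (\<exists>y. is_arg_min (bilevel_objective G) (\<lambda>_. True) y \<and>
        (\<forall>i\<in>players G. is_arg_min (pseudo_variance G i y) (\<lambda>v. v \<in> admissible_policies G i) (u i)))"
    if u: "u \<in> joint_policies G" for u
  proof
    assume "is_arg_min (team_variance G) (\<lambda>u. u \<in> joint_policies G) u"
    then have tv: "team_variance G u = team_variance G w" using team_opt u by simp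
    let ?y = "team_mean G u"
    have y: "bilevel_objective G ?y = team_variance G w"
      using bl_mean[OF u] bl_ge[of ?y] tv by simp
    obtain d where d: "d \<in> D" "\<forall>i\<in>players G. \<forall>v\<in>admissible_policies G i.
      pseudo_variance G i ?y (d i) \<le> pseudo_variance G i ?y v" using inner by blast
    \<comment> \<open>The sums over the players agree and the terms are ordered, so the terms agree.\<close>
    have le: "pseudo_variance G i ?y (d i) \<le> pseudo_variance G i ?y (u i)" if "i \<in> players G" for i
      using d that joint_policies_admissible[OF u] by blast
    have "(\<Sum>i\<in>players G. pseudo_variance G i ?y (d i)) = (\<Sum>i\<in>players G. pseudo_variance G i ?y (u i))"
      using bilevel[of d ?y] d D_sub y tv team_variance_eq[OF assms(1) u] by auto
    then have eq: "pseudo_variance G i ?y (d i) = pseudo_variance G i ?y (u i)" if "i \<in> players G" for i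
      by (rule sum_mono_inv) (use le that fin in auto)
    show "\<exists>y. is_arg_min (bilevel_objective G) (\<lambda>_. True) y \<and>
        (\<forall>i\<in>players G. is_arg_min (pseudo_variance G i y) (\<lambda>v. v \<in> admissible_policies G i) (u i))"
      using y eq d(2) joint_policies_admissible[OF u]
      by (intro exI[of _ ?y]) (simp add: bl_opt[unfolded is_arg_min_iff_le] is_arg_min_iff_le bl_ge)
  next
    assume "\<exists>y. is_arg_min (bilevel_objective G) (\<lambda>_. True) y \<and>
        (\<forall>i\<in>players G. is_arg_min (pseudo_variance G i y) (\<lambda>v. v \<in> admissible_policies G i) (u i))"
    then obtain y where y: "bilevel_objective G y = team_variance G w"
      and opt: "\<forall>i\<in>players G. \<forall>v\<in>admissible_policies G i.
        pseudo_variance G i y (u i) \<le> pseudo_variance G i y v"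
      unfolding bl_opt by (auto simp: is_arg_min_iff_le)
    have "team_variance G u \<le> team_variance G w"
      using tv_le[OF u, of y] bilevel[OF u opt] y by simp
    then show "is_arg_min (team_variance G) (\<lambda>u. u \<in> joint_policies G) u"
      using team_opt[OF u] w_opt[OF u] by simp
  qed
  show ?thesis
  proof (intro conjI allI ballI)
    show "\<exists>u. is_arg_min (team_variance G) (\<lambda>u. u \<in> joint_policies G) u"
      using team_opt w_joint by blast
    show "\<exists>v. is_arg_min (pseudo_variance G i y) (\<lambda>v. v \<in> admissible_policies G i) v"
      if "i \<in> players G" for y i
      using inner[of y] that D_sub joint_policies_admissible
      by (metis is_arg_min_iff_le subsetD)
    show "\<exists>y. is_arg_min (bilevel_objective G) (\<lambda>_. True) y"
      using bl_opt attained by blast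
    show "(INF u\<in>joint_policies G. team_variance G u) = (INF y. bilevel_objective G y)"
      using infs by simp
  qed (rule equiv)
qed

end
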